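(* Let $(\Omega,\mathcal{A},\mu)$ be a nonatomic measure space. (a) If the measure space is $\sigma$-finite and there is a countable family $\mathcal{A}_1\subset\mathcal{A}$ such that, for every $M\in\mathcal{A}$ with $\mu(M)<\infty$ and every $\varepsilon>0$, there exists $M_0\in\mathcal{A}_1$ with $\mu(M\,\Delta\,M_0)<\varepsilon$, then $\mathcal{S}_m\setminus\left(\mathcal{S}_p\cup\bigcup_{q>0}\mathcal{S}_{L_q}\right)$ is $\mathfrak{c}$-dense-lineable in $L_0^{\mathbb{N}}$. (b) If the measure space is semifinite, then $\mathcal{S}_m\setminus\left(\mathcal{S}_p\cup\bigcup_{q>0}\mathcal{S}_{L_q}\right)$ is spaceable in $L_0^{\mathbb{N}}$.
   Context: $(\Omega,\mathcal{A},\mu)$ is a positive measure space with $\mu(\Omega)>0$; $A\,\Delta\,B=(A\setminus B)\cup(B\setminus A)$. It is $\sigma$-finite if $\Omega$ is a countable union of measurable sets of finite measure, and semifinite if $\mu(A)=\sup\{\mu(B):B\in\mathcal{A},\,B\subset A,\,\mu(B)<\infty\}$ for each $A\in\mathcal{A}$. An atom is a set $A\in\mathcal{A}$ with $\mu(A)>0$ for which there do not exist $B,C\in\mathcal{A}$ with $B\cap C=\varnothing$, $B\cup C=A$, $\mu(B)>0$ and $\mu(C)>0$; the measure space is nonatomic if it has no atoms. $L_0$ is the real vector space of ($\mu$-a.e. equality classes of) measurable functions $f:\Omega\to\mathbb{R}$, with the topology of local convergence in measure, i.e. the vector topology with a base of $0$-neighborhoods given by the sets $\{f\in L_0:\int_K\min\{1,|f|\}\,d\mu<\varepsilon\}$,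 $\varepsilon>0$, $K\in\mathcal{A}$, $\mu(K)<\infty$. $L_0^{\mathbb{N}}$ is the vector space of all sequences $(f_n)_{n\in\mathbb{N}}$ in $L_0$, with the product topology. Subsets of $L_0^{\mathbb{N}}$: $\mathcal{S}_p$: sequences with $f_n\to0$ pointwise almost everywhere. $\mathcal{S}_m$: $f_n\to0$ in measure ($\lim_n\mu(\{|f_n|>\varepsilon\})=0$ for every $\varepsilon>0$). $\mathcal{S}_{L_q}$ ($q\in(0,+\infty)$): $\lim_n\int_\Omega|f_n|^q\,d\mu=0$. $\mathfrak{c}$ is the cardinality of the continuum. A subset $A$ of a topological vector space $X$ is $\mathfrak{c}$-dense-lineable in $X$ if there is a dense vector subspace $V\subset X$ with $\dim(V)=\mathfrak{c}$ and $V\setminus\{0\}\subset A$; it is spaceable in $X$ if there is a closed infinite dimensional vector subspace $V\subset X$ with $V\setminus\{0\}\subset A$. *)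

theory Defs
  imports
    "HOL-Analysis.Analysis"
    "HOL-Library.Equipollence"
    "Jordan_Normal_Form.VS_Connect"
begin

section \<open>Measure spaces\<close>

definition atom_of :: "'a measure \<Rightarrow> 'a set \<Rightarrow> bool" where
  "atom_of M A \<longleftrightarrow> A \<in> sets M \<and> emeasure M A > 0 \<and>
     \<not> (\<exists>B\<in>sets M. \<exists>C\<in>sets M. B \<inter> C = {} \<and> B \<union> C = A \<and> emeasure M B > 0 \<and> emeasure M C > 0)"

definition nonatomic :: "'a measure \<Rightarrow> bool" where
  "nonatomic M \<longleftrightarrow> (\<nexists>A. atom_of M A)"

text \<open>The library locale \<open>semifinite_measure\<close> does not require the subset of finite measure to have
  positive measure, so that it holds for every measure (take the empty set).\<close>

definition semifinite :: "'a measure \<Rightarrow> bool" where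
  "semifinite M \<longleftrightarrow> (\<forall>A\<in>sets M.
     emeasure M A = (SUP B\<in>{B \<in> sets M. B \<subseteq> A \<and> emeasure M B < \<infinity>}. emeasure M B))"


section \<open>The vector space of classes of measurable functions\<close>

definition ae_rel :: "'a measure \<Rightarrow> (('a \<Rightarrow> real) \<times> ('a \<Rightarrow> real)) set" where
  "ae_rel M = {(f, g). f \<in> borel_measurable M \<and> g \<in> borel_measurable M \<and> (AE x in M. f x = g x)}"

definition ae_class :: "'a measure \<Rightarrow> ('a \<Rightarrow> real) \<Rightarrow> ('a \<Rightarrow> real) set" where
  "ae_class M f = ae_rel M `` {f}"

text \<open>Only the additive and scalar structure of the record matters; there is no ring
  multiplication on the vectors.\<close>

definition L0 :: "'a measure \<Rightarrow> (real, ('a \<Rightarrow> real) set) module" where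
  "L0 M = \<lparr>carrier = borel_measurable M // ae_rel M,
     mult = undefined, one = undefined,
     zero = ae_class M (\<lambda>x. 0),
     add = (\<lambda>F G. \<Union>f\<in>F. \<Union>g\<in>G. ae_class M (\<lambda>x. f x + g x)),
     smult = (\<lambda>c F. \<Union>f\<in>F. ae_class M (\<lambda>x. c * f x))\<rparr>"

definition seq_module :: "(real, 'v) module \<Rightarrow> (real, nat \<Rightarrow> 'v) module" where
  "seq_module X = \<lparr>carrier = {F. \<forall>n. F n \<in> carrier X},
     mult = undefined, one = undefined,
     zero = (\<lambda>n. \<zero>\<^bsub>X\<^esub>),
     add = (\<lambda>F G n. F n \<oplus>\<^bsub>X\<^esub> G n),
     smult = (\<lambda>c F n. c \<odot>\<^bsub>X\<^esub> F n)\<rparr>"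

abbreviation L0_seq :: "'a measure \<Rightarrow> (real, nat \<Rightarrow> ('a \<Rightarrow> real) set) module" where
  "L0_seq M \<equiv> seq_module (L0 M)"


section \<open>Local convergence in measure\<close>

definition L0_nhd :: "'a measure \<Rightarrow> 'a set \<Rightarrow> real \<Rightarrow> ('a \<Rightarrow> real) set set" where
  "L0_nhd M K e = ae_class M ` {f \<in> borel_measurable M.
     (\<integral>\<^sup>+x\<in>K. ennreal (min 1 \<bar>f x\<bar>) \<partial>M) < ennreal e}"

text \<open>The sets \<open>L0_nhd M K e\<close> are a base of neighbourhoods of zero, and a vector topology is
  translation invariant, so the neighbourhoods of \<open>F\<close> are the translates of these sets by \<open>F\<close>.\<close>

definition L0_topology :: "'a measure \<Rightarrow> ('a \<Rightarrow> real) set topology" where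
  "L0_topology M = topology (\<lambda>U. U \<subseteq> carrier (L0 M) \<and>
     (\<forall>F\<in>U. \<exists>K\<in>sets M. \<exists>e>0. emeasure M K < \<infinity> \<and> (\<lambda>G. F \<oplus>\<^bsub>L0 M\<^esub> G) ` L0_nhd M K e \<subseteq> U))"

abbreviation L0_seq_topology :: "'a measure \<Rightarrow> (nat \<Rightarrow> ('a \<Rightarrow> real) set) topology" where
  "L0_seq_topology M \<equiv> product_topology (\<lambda>n. L0_topology M) UNIV"


section \<open>Sets of sequences\<close>

definition seq_class :: "'a measure \<Rightarrow> (nat \<Rightarrow> 'a \<Rightarrow> real) \<Rightarrow> nat \<Rightarrow> ('a \<Rightarrow> real) set" where
  "seq_class M f = (\<lambda>n. ae_class M (f n))"

definition S_p :: "'a measure \<Rightarrow> (nat \<Rightarrow> ('a \<Rightarrow> real) set) set" where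
  "S_p M = seq_class M ` {f. (\<forall>n. f n \<in> borel_measurable M) \<and>
     (AE x in M. (\<lambda>n. f n x) \<longlonglongrightarrow> 0)}"

definition S_m :: "'a measure \<Rightarrow> (nat \<Rightarrow> ('a \<Rightarrow> real) set) set" where
  "S_m M = seq_class M ` {f. (\<forall>n. f n \<in> borel_measurable M) \<and>
     (\<forall>e>0. (\<lambda>n. emeasure M {x \<in> space M. \<bar>f n x\<bar> > e}) \<longlonglongrightarrow> 0)}"

definition S_L :: "'a measure \<Rightarrow> real \<Rightarrow> (nat \<Rightarrow> ('a \<Rightarrow> real) set) set" where
  "S_L M q = seq_class M ` {f. (\<forall>n. f n \<in> borel_measurable M) \<and>
     (\<lambda>n. \<integral>\<^sup>+x. ennreal (\<bar>f n x\<bar> powr q) \<partial>M) \<longlonglongrightarrow> 0}"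


section \<open>Lineability\<close>

no_notation eq_closure_of ("closure'_of\<index>")

text \<open>A topological vector space is given by a real vector space \<open>X\<close> and a topology \<open>T\<close> on its
  carrier.\<close>

definition c_dense_lineable ::
    "(real, 'v) module \<Rightarrow> 'v topology \<Rightarrow> 'v set \<Rightarrow> bool" where
  "c_dense_lineable X T A \<longleftrightarrow> (\<exists>V. VectorSpace.subspace class_ring V X \<and>
     T closure_of V = topspace T \<and>
     (\<exists>B. vectorspace.basis class_ring (X\<lparr>carrier := V\<rparr>) B \<and> B \<approx> (UNIV :: real set)) \<and>
     V - {\<zero>\<^bsub>X\<^esub>} \<subseteq> A)"

definition spaceable ::
    "(real, 'v) module \<Rightarrow> 'v topology \<Rightarrow> 'v set \<Rightarrow> bool" where
  "spaceable X T A \<longleftrightarrow> (\<exists>V. VectorSpace.subspace class_ring V X \<and>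
     closedin T V \<and>
     \<not> vectorspace.fin_dim class_ring (X\<lparr>carrier := V\<rparr>) \<and>
     V - {\<zero>\<^bsub>X\<^esub>} \<subseteq> A)"


section \<open>Basic facts\<close>

lemma equiv_ae_rel: "equiv (borel_measurable M) (ae_rel M)"
proof (rule equivI)
  show "refl_on (borel_measurable M) (ae_rel M)"
    by (auto simp: refl_on_def ae_rel_def)
  show "sym (ae_rel M)"
  proof (rule symI)
    fix f g assume "(f, g) \<in> ae_rel M"
    then have m: "f \<in> borel_measurable M" "g \<in> borel_measurable M" and a: "AE x in M. f x = g x"
      by (simp_all add: ae_rel_def)
    from a have "AE x in M. g x = f x" by eventually_elim simp
    then show "(g, f) \<in> ae_rel M" using m by (simp add: ae_rel_def)
  qed
  show "trans (ae_rel M)"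
  proof (rule transI)
    fix f g h assume "(f, g) \<in> ae_rel M" "(g, h) \<in> ae_rel M"
    then have m: "f \<in> borel_measurable M" "h \<in> borel_measurable M"
      and a: "AE x in M. f x = g x" "AE x in M. g x = h x"
      by (simp_all add: ae_rel_def)
    from a have "AE x in M. f x = h x" by eventually_elim simp
    then show "(f, h) \<in> ae_rel M" using m by (simp add: ae_rel_def)
  qed
  show "ae_rel M \<subseteq> borel_measurable M \<times> borel_measurable M"
    by (auto simp: ae_rel_def)
qed

lemma carrier_L0: "carrier (L0 M) = ae_class M ` borel_measurable M"
  by (auto simp: L0_def ae_class_def quotient_def)

lemma ae_class_in_carrier [intro]: "f \<in> borel_measurable M \<Longrightarrow> ae_class M f \<in> carrier (L0 M)"
  by (simp add: carrier_L0)

lemma ae_class_eq_iff: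
  assumes "f \<in> borel_measurable M" "g \<in> borel_measurable M"
  shows "ae_class M f = ae_class M g \<longleftrightarrow> (AE x in M. f x = g x)"
  using eq_equiv_class_iff[OF equiv_ae_rel assms] assms by (simp add: ae_class_def ae_rel_def)

lemma mem_ae_class_iff:
  assumes "f \<in> borel_measurable M"
  shows "g \<in> ae_class M f \<longleftrightarrow> g \<in> borel_measurable M \<and> (AE x in M. f x = g x)"
  using assms by (auto simp: ae_class_def ae_rel_def)

lemma ae_class_cong:
  assumes "f \<in> borel_measurable M" "g \<in> borel_measurable M" "AE x in M. f x = g x"
  shows "ae_class M f = ae_class M g"
  using ae_class_eq_iff[OF assms(1,2)] assms(3) by blast

lemma L0_add:
  assumes f: "f \<in> borel_measurable M" and g: "g \<in> borel_measurable M"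
  shows "ae_class M f \<oplus>\<^bsub>L0 M\<^esub> ae_class M g = ae_class M (\<lambda>x. f x + g x)"
proof -
  have eq: "ae_class M (\<lambda>x. f' x + g' x) = ae_class M (\<lambda>x. f x + g x)"
    if f': "f' \<in> ae_class M f" and g': "g' \<in> ae_class M g" for f' g'
  proof (rule ae_class_cong)
    have [measurable]: "f' \<in> borel_measurable M" "g' \<in> borel_measurable M"
      and a: "AE x in M. f x = f' x" "AE x in M. g x = g' x"
      using f' g' by (simp_all only: mem_ae_class_iff[OF f] mem_ae_class_iff[OF g])
    from a show "AE x in M. f' x + g' x = f x + g x" by eventually_elim simp
    show "(\<lambda>x. f' x + g' x) \<in> borel_measurable M" by measurable
    show "(\<lambda>x. f x + g x) \<in> borel_measurable M" using f g by (rule borel_measurable_add)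
  qed
  have mem: "f \<in> ae_class M f" "g \<in> ae_class M g"
    using f g by (simp_all add: mem_ae_class_iff)
  have "ae_class M f \<oplus>\<^bsub>L0 M\<^esub> ae_class M g =
      (\<Union>f'\<in>ae_class M f. \<Union>g'\<in>ae_class M g. ae_class M (\<lambda>x. f' x + g' x))"
    by (simp only: L0_def ring.simps)
  also have "\<dots> = (\<Union>f'\<in>ae_class M f. \<Union>g'\<in>ae_class M g. ae_class M (\<lambda>x. f x + g x))"
    by (intro SUP_cong refl eq)
  also have "\<dots> = ae_class M (\<lambda>x. f x + g x)"
    using mem by blast
  finally show ?thesis .
qed

lemma L0_smult:
  assumes f: "f \<in> borel_measurable M"
  shows "c \<odot>\<^bsub>L0 M\<^esub> ae_class M f = ae_class M (\<lambda>x. c * f x)"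
proof -
  have eq: "ae_class M (\<lambda>x. c * f' x) = ae_class M (\<lambda>x. c * f x)"
    if f': "f' \<in> ae_class M f" for f'
  proof (rule ae_class_cong)
    have [measurable]: "f' \<in> borel_measurable M" and a: "AE x in M. f x = f' x"
      using f' by (simp_all only: mem_ae_class_iff[OF f])
    from a show "AE x in M. c * f' x = c * f x" by eventually_elim simp
    show "(\<lambda>x. c * f' x) \<in> borel_measurable M" by measurable
    show "(\<lambda>x. c * f x) \<in> borel_measurable M" using f by measurable
  qed
  have mem: "f \<in> ae_class M f"
    using f by (simp add: mem_ae_class_iff)
  have "c \<odot>\<^bsub>L0 M\<^esub> ae_class M f = (\<Union>f'\<in>ae_class M f. ae_class M (\<lambda>x. c * f' x))"
    by (simp only: L0_def module.simps)
  also have "\<dots> = (\<Union>f'\<in>ae_class M f. ae_class M (\<lambda>x. c * f x))"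
    by (intro SUP_cong refl eq)
  also have "\<dots> = ae_class M (\<lambda>x. c * f x)"
    using mem by blast
  finally show ?thesis .
qed

lemma L0_zero: "\<zero>\<^bsub>L0 M\<^esub> = ae_class M (\<lambda>x. 0)"
  by (simp add: L0_def)

lemma vectorspace_L0: "vectorspace class_ring (L0 M)"
proof -
  have "abelian_group (L0 M)"
  proof (rule abelian_groupI)
    fix F assume "F \<in> carrier (L0 M)"
    then obtain f where f: "f \<in> borel_measurable M" and F: "F = ae_class M f"
      by (auto simp: carrier_L0)
    have "ae_class M (\<lambda>x. - f x) \<oplus>\<^bsub>L0 M\<^esub> F = \<zero>\<^bsub>L0 M\<^esub>"
      using f by (simp add: F L0_add L0_zero)
    then show "\<exists>G\<in>carrier (L0 M). G \<oplus>\<^bsub>L0 M\<^esub> F = \<zero>\<^bsub>L0 M\<^esub>"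
      using f by (intro bexI[of _ "ae_class M (\<lambda>x. - f x)"]) auto
  next
    fix F G H assume "F \<in> carrier (L0 M)" "G \<in> carrier (L0 M)" "H \<in> carrier (L0 M)"
    then obtain f g h where "f \<in> borel_measurable M" "g \<in> borel_measurable M"
        "h \<in> borel_measurable M" and "F = ae_class M f" "G = ae_class M g" "H = ae_class M h"
      unfolding carrier_L0 by blast
    then show "F \<oplus>\<^bsub>L0 M\<^esub> G \<oplus>\<^bsub>L0 M\<^esub> H = F \<oplus>\<^bsub>L0 M\<^esub> (G \<oplus>\<^bsub>L0 M\<^esub> H)"
      by (simp add: L0_add add.assoc)
  next
    fix F G assume "F \<in> carrier (L0 M)" "G \<in> carrier (L0 M)"
    then obtain f g where fg: "f \<in> borel_measurable M" "g \<in> borel_measurable M"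
        and FG: "F = ae_class M f" "G = ae_class M g"
      unfolding carrier_L0 by blast
    show "F \<oplus>\<^bsub>L0 M\<^esub> G \<in> carrier (L0 M)"
      unfolding FG L0_add[OF fg] using fg by (intro ae_class_in_carrier) simp
    show "F \<oplus>\<^bsub>L0 M\<^esub> G = G \<oplus>\<^bsub>L0 M\<^esub> F"
      unfolding FG L0_add[OF fg] L0_add[OF fg(2,1)] by (simp only: add.commute)
  next
    show "\<zero>\<^bsub>L0 M\<^esub> \<in> carrier (L0 M)"
      unfolding L0_zero by (intro ae_class_in_carrier) simp
  next
    fix F assume "F \<in> carrier (L0 M)"
    then obtain f where "f \<in> borel_measurable M" "F = ae_class M f"
      unfolding carrier_L0 by blast
    then show "\<zero>\<^bsub>L0 M\<^esub> \<oplus>\<^bsub>L0 M\<^esub> F = F"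
      by (simp add: L0_add L0_zero)
  qed
  then have "Module.module class_ring (L0 M)"
  proof (rule moduleI[OF class_cring.is_cring])
    fix a :: real and F assume "F \<in> carrier (L0 M)"
    then obtain f where f: "f \<in> borel_measurable M" and F: "F = ae_class M f"
      unfolding carrier_L0 by blast
    show "a \<odot>\<^bsub>L0 M\<^esub> F \<in> carrier (L0 M)"
      unfolding F L0_smult[OF f] using f by (intro ae_class_in_carrier) simp
  next
    fix a b :: real and F assume "F \<in> carrier (L0 M)"
    then obtain f where f: "f \<in> borel_measurable M" and F: "F = ae_class M f"
      unfolding carrier_L0 by blast
    show "(a \<oplus>\<^bsub>class_ring\<^esub> b) \<odot>\<^bsub>L0 M\<^esub> F = a \<odot>\<^bsub>L0 M\<^esub> F \<oplus>\<^bsub>L0 M\<^esub> b \<odot>\<^bsub>L0 M\<^esub> F"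
      using f by (simp add: F L0_smult L0_add distrib_right)
    show "(a \<otimes>\<^bsub>class_ring\<^esub> b) \<odot>\<^bsub>L0 M\<^esub> F = a \<odot>\<^bsub>L0 M\<^esub> (b \<odot>\<^bsub>L0 M\<^esub> F)"
      using f by (simp add: F L0_smult mult.assoc)
  next
    fix a :: real and F G assume "F \<in> carrier (L0 M)" "G \<in> carrier (L0 M)"
    then obtain f g where "f \<in> borel_measurable M" "g \<in> borel_measurable M"
        and "F = ae_class M f" "G = ae_class M g"
      unfolding carrier_L0 by blast
    then show "a \<odot>\<^bsub>L0 M\<^esub> (F \<oplus>\<^bsub>L0 M\<^esub> G) = a \<odot>\<^bsub>L0 M\<^esub> F \<oplus>\<^bsub>L0 M\<^esub> a \<odot>\<^bsub>L0 M\<^esub> G"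
      by (simp add: L0_smult L0_add distrib_left)
  next
    fix F assume "F \<in> carrier (L0 M)"
    then obtain f where "f \<in> borel_measurable M" "F = ae_class M f"
      unfolding carrier_L0 by blast
    then show "\<one>\<^bsub>class_ring\<^esub> \<odot>\<^bsub>L0 M\<^esub> F = F"
      by (simp add: L0_smult)
  qed
  then show ?thesis
    by (rule vectorspace.intro[OF _ VS_Connect.class_field])
qed

lemma vectorspace_seq_module:
  assumes "vectorspace class_ring X"
  shows "vectorspace class_ring (seq_module X)"
proof -
  interpret X: vectorspace class_ring X by fact
  have "abelian_group (seq_module X)"
  proof (rule abelian_groupI)
    fix F assume "F \<in> carrier (seq_module X)"
    then show "\<exists>G\<in>carrier (seq_module X). G \<oplus>\<^bsub>seq_module X\<^esub> F = \<zero>\<^bsub>seq_module X\<^esub>"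
      by (intro bexI[of _ "\<lambda>n. \<ominus>\<^bsub>X\<^esub> F n"]) (auto simp: seq_module_def X.l_neg)
  next
    fix F G H assume "F \<in> carrier (seq_module X)" "G \<in> carrier (seq_module X)"
      "H \<in> carrier (seq_module X)"
    then show "F \<oplus>\<^bsub>seq_module X\<^esub> G \<oplus>\<^bsub>seq_module X\<^esub> H =
        F \<oplus>\<^bsub>seq_module X\<^esub> (G \<oplus>\<^bsub>seq_module X\<^esub> H)"
      by (simp add: seq_module_def X.a_assoc)
  next
    fix F G assume "F \<in> carrier (seq_module X)" "G \<in> carrier (seq_module X)"
    then show "F \<oplus>\<^bsub>seq_module X\<^esub> G = G \<oplus>\<^bsub>seq_module X\<^esub> F"
      by (auto simp: seq_module_def intro!: ext X.a_comm)
  qed (simp_all add: seq_module_def)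
  then have "Module.module class_ring (seq_module X)"
  proof (rule moduleI[OF class_cring.is_cring])
  qed (use X.smult_l_distr X.smult_r_distr X.smult_assoc1 X.smult_one in
      \<open>simp_all add: seq_module_def\<close>)
  then show ?thesis
    by (rule vectorspace.intro[OF _ VS_Connect.class_field])
qed

lemma vectorspace_L0_seq: "vectorspace class_ring (L0_seq M)"
  by (intro vectorspace_seq_module vectorspace_L0)

lemma ae_class_in_L0_nhd_iff:
  assumes f: "f \<in> borel_measurable M"
  shows "ae_class M f \<in> L0_nhd M K e \<longleftrightarrow>
    (\<integral>\<^sup>+x\<in>K. ennreal (min 1 \<bar>f x\<bar>) \<partial>M) < ennreal e"
proof
  assume "ae_class M f \<in> L0_nhd M K e"
  then obtain g where g: "g \<in> borel_measurable M" "ae_class M f = ae_class M g"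
    and lt: "(\<integral>\<^sup>+x\<in>K. ennreal (min 1 \<bar>g x\<bar>) \<partial>M) < ennreal e"
    by (auto simp: L0_nhd_def)
  from g have "AE x in M. f x = g x" using f by (simp add: ae_class_eq_iff)
  then have "(\<integral>\<^sup>+x\<in>K. ennreal (min 1 \<bar>f x\<bar>) \<partial>M) = (\<integral>\<^sup>+x\<in>K. ennreal (min 1 \<bar>g x\<bar>) \<partial>M)"
    by (intro nn_integral_cong_AE) (auto elim: eventually_mono)
  then show "(\<integral>\<^sup>+x\<in>K. ennreal (min 1 \<bar>f x\<bar>) \<partial>M) < ennreal e" using lt by simp
qed (use f in \<open>auto simp: L0_nhd_def\<close>)

lemma L0_nhd_subset_carrier: "L0_nhd M K e \<subseteq> carrier (L0 M)"
  by (auto simp: L0_nhd_def)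

lemma L0_nhd_mono:
  assumes "K \<subseteq> K'" "e' \<le> e"
  shows "L0_nhd M K' e' \<subseteq> L0_nhd M K e"
proof -
  have "(\<integral>\<^sup>+x\<in>K. ennreal (min 1 \<bar>f x\<bar>) \<partial>M) \<le> (\<integral>\<^sup>+x\<in>K'. ennreal (min 1 \<bar>f x\<bar>) \<partial>M)" for f
    using assms by (intro nn_integral_mono) (auto simp: indicator_def)
  then show ?thesis
    using ennreal_leI[OF assms(2)] unfolding L0_nhd_def
    by (auto intro!: imageI dest: order.strict_trans2 le_less_trans)
qed

lemma openin_L0_topology:
  "openin (L0_topology M) U \<longleftrightarrow> U \<subseteq> carrier (L0 M) \<and>
     (\<forall>F\<in>U. \<exists>K\<in>sets M. \<exists>e>0. emeasure M K < \<infinity> \<and> (\<lambda>G. F \<oplus>\<^bsub>L0 M\<^esub> G) ` L0_nhd M K e \<subseteq> U)"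
proof -
  define P where "P = (\<lambda>U. U \<subseteq> carrier (L0 M) \<and>
     (\<forall>F\<in>U. \<exists>K\<in>sets M. \<exists>e>0. emeasure M K < \<infinity> \<and> (\<lambda>G. F \<oplus>\<^bsub>L0 M\<^esub> G) ` L0_nhd M K e \<subseteq> U))"
  have "P (U \<inter> V)" if U: "P U" and V: "P V" for U V
    unfolding P_def
  proof (intro conjI ballI)
    show "U \<inter> V \<subseteq> carrier (L0 M)" using U by (auto simp: P_def)
    fix F assume F: "F \<in> U \<inter> V"
    obtain K e where K: "K \<in> sets M" "e > 0" "emeasure M K < \<infinity>"
        "(\<lambda>G. F \<oplus>\<^bsub>L0 M\<^esub> G) ` L0_nhd M K e \<subseteq> U"
      using U F unfolding P_def by blast
    obtain K' e' where K': "K' \<in> sets M" "e' > 0" "emeasure M K' < \<infinity>"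
        "(\<lambda>G. F \<oplus>\<^bsub>L0 M\<^esub> G) ` L0_nhd M K' e' \<subseteq> V"
      using V F unfolding P_def by blast
    have "emeasure M (K \<union> K') \<le> emeasure M K + emeasure M K'"
      using K K' by (intro emeasure_subadditive) auto
    also have "\<dots> < \<infinity>" using K K' by (simp add: ennreal_add_less_top)
    finally have fin: "emeasure M (K \<union> K') < \<infinity>" .
    have "L0_nhd M (K \<union> K') (min e e') \<subseteq> L0_nhd M K e \<inter> L0_nhd M K' e'"
      using L0_nhd_mono[of K "K \<union> K'" "min e e'" e M] L0_nhd_mono[of K' "K \<union> K'" "min e e'" e' M]
      by auto
    then have "(\<lambda>G. F \<oplus>\<^bsub>L0 M\<^esub> G) ` L0_nhd M (K \<union> K') (min e e') \<subseteq> U \<inter> V"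
      using K(4) K'(4) by blast
    then show "\<exists>K\<in>sets M. \<exists>e>0. emeasure M K < \<infinity> \<and> (\<lambda>G. F \<oplus>\<^bsub>L0 M\<^esub> G) ` L0_nhd M K e \<subseteq> U \<inter> V"
      using K K' fin by (intro bexI[of _ "K \<union> K'"] exI[of _ "min e e'"]) auto
  qed
  moreover have "P (\<Union>\<K>)" if P: "\<forall>U\<in>\<K>. P U" for \<K>
    unfolding P_def
  proof (intro conjI ballI)
    show "\<Union>\<K> \<subseteq> carrier (L0 M)" using P by (auto simp: P_def)
    fix F assume "F \<in> \<Union>\<K>"
    then obtain U where U: "U \<in> \<K>" "F \<in> U" by auto
    from P U(1) have "P U" by blast
    then obtain K e where "K \<in> sets M" "e > 0" "emeasure M K < \<infinity>"
        "(\<lambda>G. F \<oplus>\<^bsub>L0 M\<^esub> G) ` L0_nhd M K e \<subseteq> U"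
      using U(2) unfolding P_def by blast
    then show "\<exists>K\<in>sets M. \<exists>e>0. emeasure M K < \<infinity> \<and> (\<lambda>G. F \<oplus>\<^bsub>L0 M\<^esub> G) ` L0_nhd M K e \<subseteq> \<Union>\<K>"
      using U by blast
  qed
  ultimately have "istopology P"
    unfolding istopology_def by blast
  then have "openin (topology P) U \<longleftrightarrow> P U"
    by (simp add: topology_inverse')
  then show ?thesis by (simp add: L0_topology_def P_def)
qed

lemma topspace_L0_topology: "topspace (L0_topology M) = carrier (L0 M)"
proof -
  interpret vectorspace class_ring "L0 M" by (rule vectorspace_L0)
  have "(\<lambda>G. F \<oplus>\<^bsub>L0 M\<^esub> G) ` L0_nhd M {} 1 \<subseteq> carrier (L0 M)" if "F \<in> carrier (L0 M)" for F
    using that L0_nhd_subset_carrier[of M] by auto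
  then have "openin (L0_topology M) (carrier (L0 M))"
    unfolding openin_L0_topology
    by (intro conjI ballI bexI[of _ "{}"] exI[of _ 1]) auto
  then show ?thesis
    unfolding topspace_def by (auto simp: openin_L0_topology)
qed

lemma topspace_L0_seq_topology: "topspace (L0_seq_topology M) = carrier (L0_seq M)"
  by (auto simp: topspace_product_topology topspace_L0_topology seq_module_def PiE_def Pi_def)

lemma openin_L0_nhd:
  assumes K: "K \<in> sets M" "emeasure M K < \<infinity>"
  shows "openin (L0_topology M) (L0_nhd M K e)"
  unfolding openin_L0_topology
proof (intro conjI ballI L0_nhd_subset_carrier)
  fix F assume "F \<in> L0_nhd M K e"
  then obtain f where f: "f \<in> borel_measurable M" and F: "F = ae_class M f"
    and lt: "(\<integral>\<^sup>+x\<in>K. ennreal (min 1 \<bar>f x\<bar>) \<partial>M) < ennreal e" (is "?I < _")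
    by (auto simp: L0_nhd_def)
  obtain r where r: "?I = ennreal r" "r \<ge> 0"
    using lt by (cases ?I rule: ennreal_cases) auto
  have re: "r < e" using lt r by (simp add: ennreal_less_iff)
  have "F \<oplus>\<^bsub>L0 M\<^esub> G \<in> L0_nhd M K e" if mem: "G \<in> L0_nhd M K (e - r)" for G
  proof -
    obtain g where g: "g \<in> borel_measurable M" and G: "G = ae_class M g"
      and ltg: "(\<integral>\<^sup>+x\<in>K. ennreal (min 1 \<bar>g x\<bar>) \<partial>M) < ennreal (e - r)" (is "?J < _")
      using mem by (auto simp: L0_nhd_def)
    have "ennreal (min 1 \<bar>f x + g x\<bar>) \<le> ennreal (min 1 \<bar>f x\<bar>) + ennreal (min 1 \<bar>g x\<bar>)" for x
    proof -
      have "min 1 \<bar>f x + g x\<bar> \<le> min 1 \<bar>f x\<bar> + min 1 \<bar>g x\<bar>" by linarith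
      then have "ennreal (min 1 \<bar>f x + g x\<bar>) \<le> ennreal (min 1 \<bar>f x\<bar> + min 1 \<bar>g x\<bar>)"
        by (rule ennreal_leI)
      also have "\<dots> = ennreal (min 1 \<bar>f x\<bar>) + ennreal (min 1 \<bar>g x\<bar>)"
        by (rule ennreal_plus) simp_all
      finally show ?thesis .
    qed
    then have "(\<integral>\<^sup>+x\<in>K. ennreal (min 1 \<bar>f x + g x\<bar>) \<partial>M)
        \<le> (\<integral>\<^sup>+x. ennreal (min 1 \<bar>f x\<bar>) * indicator K x + ennreal (min 1 \<bar>g x\<bar>) * indicator K x \<partial>M)"
      by (intro nn_integral_mono) (auto simp: indicator_def)
    also have "\<dots> = ?I + ?J"
      using f g K by (intro nn_integral_add) auto
    also have "\<dots> < ennreal r + ennreal (e - r)"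
      unfolding r(1) using ltg by (simp add: ennreal_add_left_cancel_less)
    also have "\<dots> = ennreal e"
      using r re by (simp flip: ennreal_plus)
    finally show ?thesis
      using f g by (simp add: F G L0_add ae_class_in_L0_nhd_iff)
  qed
  then show "\<exists>K'\<in>sets M. \<exists>e'>0. emeasure M K' < \<infinity> \<and> (\<lambda>G. F \<oplus>\<^bsub>L0 M\<^esub> G) ` L0_nhd M K' e' \<subseteq> L0_nhd M K e"
    using K re by (intro bexI[of _ K] exI[of _ "e - r"]) auto
qed

end

theory Submission
  imports Defs "HOL-Real_Asymp.Real_Asymp"
begin

text \<open>On a set \<open>W\<close> of finite positive measure there is a typewriter sequence \<open>h\<close> of bounded functions: they
  live on sets of measure tending to \<open>0\<close> that sweep over \<open>W\<close> infinitely often, and their heights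
  grow so fast that every product \<open>(\<phi> h\<^sub>n)\<^sub>n\<close> with \<open>\<phi> \<noteq> 0\<close> on a nonnull part of \<open>W\<close> tends to \<open>0\<close> in measure,
  but neither almost everywhere nor in any \<open>L\<^sub>q\<close>.

  If \<open>h\<^sub>0\<close> is the indicator function of \<open>W\<close>, then the space of all these products is
  \<open>{F. F\<^sub>n = h\<^sub>n F\<^sub>0 for all n}\<close>, which is closed; this gives (b).

  For (a), the functions \<open>\<phi>\<^sub>y = y ^ (\<kappa> + 1)\<close>, \<open>0 < y < 1\<close>, are linearly independent for
  any \<open>\<nat>\<close>-valued \<open>\<kappa>\<close> that takes every value on a set of positive measure.
  The sequences \<open>d\<^sub>y + \<phi>\<^sub>y h\<close> span the required space, where the \<open>d\<^sub>y\<close> are eventually zero and hence do not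
  affect convergence, and every member of a countable dense set of
  eventually zero sequences occurs as \<open>d\<^sub>y\<close> for arbitrarily small \<open>y\<close>.\<close>

section \<open>Small sets in nonatomic measure spaces\<close>

lemma nonatomic_split:
  assumes "nonatomic M" "A \<in> sets M" "emeasure M A > 0"
  obtains B C where "B \<in> sets M" "C \<in> sets M" "B \<inter> C = {}" "B \<union> C = A"
    "emeasure M B > 0" "emeasure M C > 0"
  using assms unfolding nonatomic_def atom_of_def by blast

text \<open>Of two disjoint positive parts of a set, one has at most half its measure. Repeating the
  split n times inside A leaves a positive set of measure at most
  \<open>measure M A / 2 ^ n\<close>.\<close>

lemma nonatomic_small_subset:
  assumes M: "nonatomic M" and A: "A \<in> fmeasurable M" "measure M A > 0" and e: "e > 0"
  obtains B where "B \<in> fmeasurable M" "B \<subseteq> A" "measure M B > 0" "measure M B \<le> e"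
proof -
  have halving: "\<exists>B\<in>fmeasurable M. B \<subseteq> A \<and> measure M B > 0 \<and> measure M B \<le> measure M A / 2 ^ n" for n
  proof (induction n)
    case 0
    then show ?case using A by auto
  next
    case (Suc n)
    then obtain B where B: "B \<in> fmeasurable M" "B \<subseteq> A" "measure M B > 0" "measure M B \<le> measure M A / 2 ^ n"
      by blast
    have "emeasure M B > 0"
      using B by (simp add: emeasure_eq_measure2)
    then obtain C D where CD: "C \<in> sets M" "D \<in> sets M" "C \<inter> D = {}" "C \<union> D = B"
        "emeasure M C > 0" "emeasure M D > 0"
      using nonatomic_split[OF M fmeasurableD[OF B(1)]] by metis
    have f: "C \<in> fmeasurable M" "D \<in> fmeasurable M"
      using CD B(1) by (auto intro: fmeasurableI2)
    have "measure M B = measure M C + measure M D"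
      using measure_Un3[OF f] CD by simp
    then have "measure M C \<le> measure M A / 2 ^ Suc n \<or> measure M D \<le> measure M A / 2 ^ Suc n"
      using B(4) by (simp add: field_simps) linarith
    moreover have "measure M C > 0" "measure M D > 0"
      using CD f by (simp_all add: emeasure_eq_measure2)
    ultimately show ?case
      using f CD(4) B(2) by blast
  qed
  obtain n where "measure M A / e < 2 ^ n"
    using real_arch_pow[of 2] by auto
  then have "measure M A / 2 ^ n \<le> e"
    using e by (simp add: field_simps)
  then show ?thesis
    using halving[of n] that by fastforce
qed

text \<open>The sets that are finite unions of small sets come arbitrarily close to the supremum of
  their measures, and a countable union of them that attains the supremum can only miss a null set of \<open>A\<close>,
  as otherwise a small subset of the rest could be added.\<close>

lemma nonatomic_finite_cover:
  assumes M: "nonatomic M" and A: "A \<in> fmeasurable M" and e: "e > 0"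
  obtains \<B> where "finite \<B>" "\<B> \<subseteq> fmeasurable M" "\<Union>\<B> = A" "\<And>B. B \<in> \<B> \<Longrightarrow> measure M B \<le> e"
proof -
  define P where "P X \<longleftrightarrow> (\<exists>\<B>. finite \<B> \<and> \<B> \<subseteq> fmeasurable M \<and> \<Union>\<B> = X \<and> X \<subseteq> A \<and>
    (\<forall>B\<in>\<B>. measure M B \<le> e))" for X
  have P_Un: "P (X \<union> Y)" if X: "P X" and Y: "P Y" for X Y
  proof -
    obtain \<B> \<C> where "finite \<B> \<and> \<B> \<subseteq> fmeasurable M \<and> \<Union>\<B> = X \<and> X \<subseteq> A \<and> (\<forall>B\<in>\<B>. measure M B \<le> e)"
      "finite \<C> \<and> \<C> \<subseteq> fmeasurable M \<and> \<Union>\<C> = Y \<and> Y \<subseteq> A \<and> (\<forall>B\<in>\<C>. measure M B \<le> e)"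
      using X Y unfolding P_def by metis
    then show ?thesis
      unfolding P_def by (intro exI[of _ "\<B> \<union> \<C>"]) auto
  qed
  have P_small: "P X" if "X \<in> fmeasurable M" "X \<subseteq> A" "measure M X \<le> e" for X
    unfolding P_def using that by (intro exI[of _ "{X}"]) auto
  have P_empty: "P {}"
    unfolding P_def by (intro exI[of _ "{}"]) auto
  have P_fm: "X \<in> fmeasurable M" "X \<subseteq> A" if X: "P X" for X
  proof -
    show "X \<subseteq> A" using X by (auto simp: P_def)
    show "X \<in> fmeasurable M" using X fmeasurable.finite_Union unfolding P_def by auto
  qed
  define s where "s = (SUP X\<in>Collect P. measure M X)"
  have bdd: "bdd_above (measure M ` Collect P)"
    using P_fm A by (intro bdd_aboveI[of _ "measure M A"]) (auto intro!: measure_mono_fmeasurable)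
  have le_s: "measure M X \<le> s" if "P X" for X
    unfolding s_def using that bdd by (auto intro!: cSUP_upper)
  have "\<exists>X. P X \<and> s - 1 / Suc n < measure M X" for n
  proof -
    have "s - 1 / Suc n < s" by simp
    moreover have "s - 1 / Suc n < s \<longleftrightarrow> (\<exists>X\<in>Collect P. s - 1 / Suc n < measure M X)"
      unfolding s_def using P_empty bdd by (intro less_cSUP_iff) auto
    ultimately show ?thesis by blast
  qed
  then obtain X where X: "\<And>n. P (X n)" "\<And>n. s - 1 / Suc n < measure M (X n)"
    by metis
  define Y where "Y n = (\<Union>i<n. X i)" for n
  have Y: "P (Y n)" for n
    by (induction n) (auto simp: Y_def lessThan_Suc P_empty intro: P_Un X)
  define U where "U = (\<Union>n. X n)"
  have U: "U \<in> sets M"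
    using P_fm X unfolding U_def by (intro sets.countable_UN) (auto dest: fmeasurableD)
  have AU: "A - U \<in> fmeasurable M"
    using A U by (auto intro: fmeasurable_Diff)
  have null: "measure M (A - U) = 0"
  proof (rule ccontr)
    assume "measure M (A - U) \<noteq> 0"
    then have "measure M (A - U) > 0"
      by (simp add: zero_less_measure_iff)
    then obtain B where B: "B \<in> fmeasurable M" "B \<subseteq> A - U" "measure M B > 0" "measure M B \<le> e"
      using nonatomic_small_subset[OF M AU] e by metis
    have "P B" using B by (intro P_small) auto
    obtain n where n: "1 / Suc n < measure M B"
      using B(3) nat_approx_posE by metis
    have "X n - B = X n" using B(2) unfolding U_def by blast
    then have "measure M (X n \<union> B) = measure M (X n) + measure M B"
      using measure_Un3[OF B(1) P_fm(1)[OF X(1)], of n] measure_Un2[OF B(1) P_fm(1)[OF X(1)], of n]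
      by (simp add: Un_commute)
    moreover have "measure M (X n \<union> B) \<le> s"
      using \<open>P B\<close> X by (intro le_s P_Un)
    ultimately show False using n X(2)[of n] by linarith
  qed
  \<comment> \<open>Finiteness comes from continuity from above: the remainders
    \<open>A - Y n\<close> decrease to a null set, so one of them has measure below e and is itself
    an admissible last piece of the cover.\<close>
  have "(\<lambda>n. measure M (A - Y n)) \<longlonglongrightarrow> measure M (\<Inter>n. A - Y n)"
  proof (rule Lim_measure_decseq)
    show "range (\<lambda>n. A - Y n) \<subseteq> sets M"
      using A P_fm(1)[OF Y] by (auto dest: fmeasurableD)
    show "decseq (\<lambda>n. A - Y n)"
      by (auto simp: decseq_def Y_def)
    show "emeasure M (A - Y i) \<noteq> \<infinity>" for i
      using fmeasurable_Diff[OF A fmeasurableD[OF P_fm(1)[OF Y]], of i] by (auto simp: fmeasurable_def)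
  qed
  also have "(\<Inter>n. A - Y n) = A - U"
    by (auto simp: Y_def U_def)
  finally have "\<forall>\<^sub>F n in sequentially. measure M (A - Y n) < e"
    using null e order_tendstoD(2) by metis
  then obtain n where "measure M (A - Y n) < e"
    by (auto simp: eventually_sequentially)
  then have "P (A - Y n)"
    using A P_fm(1)[OF Y, of n] by (intro P_small fmeasurable_Diff) (auto dest: fmeasurableD)
  then have "P (Y n \<union> (A - Y n))"
    using Y by (rule P_Un[rotated])
  also have "Y n \<union> (A - Y n) = A"
    using P_fm(2)[OF Y] by blast
  finally show ?thesis
    using that unfolding P_def by metis
qed

text \<open>Repeated splitting gives a chain W = \<open>C 0\<close>, \<open>C 1\<close>, ... of
  shrinking sets with positive differences. The function \<kappa> tells in which of these layers a
  point lies.\<close>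

lemma nonatomic_partition_index:
  assumes M: "nonatomic M" and W: "W \<in> sets M" "emeasure M W > 0"
  obtains \<kappa> :: "'a \<Rightarrow> nat" where "\<kappa> \<in> measurable M (count_space UNIV)"
    "\<And>k. emeasure M {x \<in> space M. x \<in> W \<and> \<kappa> x = k} > 0"
proof -
  have "\<exists>C. \<forall>n. (C n \<in> sets M \<and> emeasure M (C n) > 0 \<and> (n = 0 \<longrightarrow> C n = W)) \<and>
      C (Suc n) \<subseteq> C n \<and> emeasure M (C n - C (Suc n)) > 0"
  proof (rule dependent_nat_choice)
    show "\<exists>A. A \<in> sets M \<and> emeasure M A > 0 \<and> ((0::nat) = 0 \<longrightarrow> A = W)"
      using W by blast
    fix A and n :: nat
    assume "A \<in> sets M \<and> emeasure M A > 0 \<and> (n = 0 \<longrightarrow> A = W)"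
    then obtain B C where "B \<in> sets M" "C \<in> sets M" "B \<inter> C = {}" "B \<union> C = A"
        "emeasure M B > 0" "emeasure M C > 0"
      using nonatomic_split[OF M, of A] by metis
    moreover from this have "A - B = C" by blast
    ultimately show "\<exists>B. (B \<in> sets M \<and> emeasure M B > 0 \<and> (Suc n = 0 \<longrightarrow> B = W)) \<and>
        B \<subseteq> A \<and> emeasure M (A - B) > 0"
      by (intro exI[of _ B]) auto
  qed
  then obtain C where C0: "C 0 = W" and C_sets [measurable]: "\<And>n. C n \<in> sets M"
    and C_dec: "\<And>n. C (Suc n) \<subseteq> C n" and C_pos: "\<And>n. emeasure M (C n - C (Suc n)) > 0"
    by auto
  have C_anti: "C n \<subseteq> C m" if "m \<le> n" for m n
    using C_dec that by (rule lift_Suc_antimono_le)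
  \<comment> \<open>For a point of every \<open>C n\<close> there is no such index and the value is
    unspecified. This is harmless, since it suffices that each layer \<open>C k - C (Suc k)\<close>
    is contained in the fibre of k.\<close>
  define \<kappa> where "\<kappa> x = (LEAST n. x \<notin> C (Suc n))" for x
  have \<kappa>_eq: "\<kappa> x = n" if "x \<in> C n - C (Suc n)" for x n
    unfolding \<kappa>_def
  proof (rule Least_equality)
    show "x \<notin> C (Suc n)" using that by blast
    fix m assume "x \<notin> C (Suc m)"
    then show "n \<le> m" using that C_anti[of "Suc m" n] by (meson DiffD1 in_mono not_less_eq_eq)
  qed
  show ?thesis
  proof (rule that)
    show "\<kappa> \<in> measurable M (count_space UNIV)"
      unfolding \<kappa>_def by measurable
    then have [measurable]: "\<kappa> \<in> measurable M (count_space UNIV)" .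
    have [measurable]: "W \<in> sets M" by fact
    fix k
    have "C k - C (Suc k) \<subseteq> {x \<in> space M. x \<in> W \<and> \<kappa> x = k}"
      using \<kappa>_eq C_anti[of 0 k] C0 sets.sets_into_space[OF C_sets] by blast
    then have "emeasure M (C k - C (Suc k)) \<le> emeasure M {x \<in> space M. x \<in> W \<and> \<kappa> x = k}"
      by (intro emeasure_mono) measurable
    then show "emeasure M {x \<in> space M. x \<in> W \<and> \<kappa> x = k} > 0"
      using C_pos[of k] by order
  qed
qed


section \<open>Typewriter sequences\<close>

text \<open>The assumptions are tailored to products \<phi> h with arbitrary measurable \<phi>.
  Controlling supports instead of values gives convergence in measure however large \<phi> is;
  arbitrary sets A in \<open>h_not_L\<close> allow restriction to a set where \<phi> is bounded away
  from 0. By \<open>h_0\<close>, the zeroth entry of a product recovers \<phi> on W, and boundedness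
  makes multiplication by each \<open>h n\<close> continuous.\<close>

locale typewriter =
  fixes M :: "'a measure" and W :: "'a set" and h :: "nat \<Rightarrow> 'a \<Rightarrow> real"
  assumes W: "W \<in> fmeasurable M"
    and measurable_h [measurable]: "\<And>n. h n \<in> borel_measurable M"
    and h_bounded: "\<And>n. \<exists>C. \<forall>x. \<bar>h n x\<bar> \<le> C"
    and h_0: "h 0 = indicator W"
    and h_outside: "\<And>n x. x \<notin> W \<Longrightarrow> h n x = 0"
    and h_support: "(\<lambda>n. emeasure M {x \<in> space M. h n x \<noteq> 0}) \<longlonglongrightarrow> 0"
    and h_not_tendsto: "\<And>x. x \<in> W \<Longrightarrow> \<not> (\<lambda>n. h n x) \<longlonglongrightarrow> 0"
    and h_not_L: "\<And>q A. \<lbrakk>q > 0; A \<in> sets M; A \<subseteq> W; emeasure M A > 0\<rbrakk> \<Longrightarrow>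
      \<not> (\<lambda>n. \<integral>\<^sup>+x\<in>A. ennreal (\<bar>h n x\<bar> powr q) \<partial>M) \<longlonglongrightarrow> 0"

text \<open>The \<open>j\<close>-th block of the sequence runs through a cover of \<open>W\<close> by finitely many sets of
  measure at most \<open>1 / (j + 1)\<close>. Its height outgrows every root of the number of sets in the cover, so
  that by pigeonhole every block has a member of large norm over any given set of positive measure.\<close>

lemma typewriter_exists:
  assumes M: "nonatomic M" and W: "W \<in> fmeasurable M" "measure M W > 0"
  obtains h where "typewriter M W h"
proof -
  \<comment> \<open>Block 0 is exempt from the size bound, so that it can consist of W alone and
    \<open>h 0\<close> becomes the indicator function of W.\<close>
  have "\<forall>j::nat. \<exists>l. set l \<subseteq> fmeasurable M \<and> \<Union>(set l) = W \<and>
      (\<forall>B\<in>set l. j > 0 \<longrightarrow> measure M B \<le> 1 / (real j + 1)) \<and> (j = 0 \<longrightarrow> l = [W])"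
    (is "\<forall>j. \<exists>l. ?P j l")
  proof
    fix j
    show "\<exists>l. ?P j l"
    proof (cases "j = 0")
      case True
      then show ?thesis using W by (intro exI[of _ "[W]"]) auto
    next
      case False
      obtain \<B> where "finite \<B>" "\<B> \<subseteq> fmeasurable M" "\<Union>\<B> = W"
          "\<And>B. B \<in> \<B> \<Longrightarrow> measure M B \<le> 1 / (real j + 1)"
        by (rule nonatomic_finite_cover[OF M W(1), of "1 / (real j + 1)"]) (simp, blast)
      moreover then obtain l where "set l = \<B>"
        using finite_list by blast
      ultimately show ?thesis using False by (intro exI[of _ l]) auto
    qed
  qed
  then have "\<exists>L. \<forall>j. ?P j (L j)"
    by (rule choice)
  then obtain L where L_all: "\<forall>j. ?P j (L j)" ..
  have L: "set (L j) \<subseteq> fmeasurable M" "\<Union>(set (L j)) = W"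
      "\<forall>B\<in>set (L j). j > 0 \<longrightarrow> measure M B \<le> 1 / (real j + 1)" "j = 0 \<longrightarrow> L j = [W]" for j
    using spec[OF L_all, of j] by blast+
  \<comment> \<open>The pair (j, i) stands for the i-th set of block j. Positions beyond the end of
    a cover are filled with the empty set, so a block has infinitely many indices but only finitely
    many of them carry a set of the cover.\<close>
  define E where "E n = (case prod_decode n of (j, i) \<Rightarrow> if i < length (L j) then L j ! i else {})" for n
  \<comment> \<open>The exponential beats every power: for each q > 0, the q-th power of the height
    exceeds the length of the block once j is large. At j = 0 the height is 1, as \<open>h 0\<close>
    requires.\<close>
  define c where "c n = (case prod_decode n of (j, i) \<Rightarrow> exp (real (j * length (L j))))" for n
  define h where "h n x = c n * indicator (E n) x" for n x
  have E_fm: "E n \<in> fmeasurable M" for n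
    using L(1) nth_mem by (fastforce simp: E_def split: prod.split)
  then have E_sets [measurable]: "E n \<in> sets M" for n
    by auto
  have E_W: "E n \<subseteq> W" for n
  proof -
    have "L j ! i \<subseteq> W" if "i < length (L j)" for i j
      using L(2)[of j] nth_mem[OF that] by blast
    then show ?thesis by (auto simp: E_def split: prod.split)
  qed
  have E_cover: "\<exists>i<length (L j). x \<in> E (prod_encode (j, i))" if "x \<in> W" for x j
  proof -
    obtain i where "i < length (L j)" "x \<in> L j ! i"
      using \<open>x \<in> W\<close> L(2)[of j] by (metis UnionE in_set_conv_nth)
    then show ?thesis by (auto simp: E_def)
  qed
  have c_ge_1: "c n \<ge> 1" for n
    by (simp add: c_def split: prod.split)
  have "typewriter M W h"
  proof
    show "W \<in> fmeasurable M" by fact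
    show "h n \<in> borel_measurable M" for n
      unfolding h_def by measurable
    show "\<exists>C. \<forall>x. \<bar>h n x\<bar> \<le> C" for n
      using c_ge_1[of n] by (intro exI[of _ "c n"]) (auto simp: h_def indicator_def)
    show "h 0 = indicator W"
      using L(4)[of 0] by (auto simp: h_def c_def E_def prod_decode_def prod_decode_aux.simps)
    show "h n x = 0" if "x \<notin> W" for n x
      using that E_W[of n] by (auto simp: h_def indicator_def)
    have supp: "{x \<in> space M. h n x \<noteq> 0} = E n" for n
      using c_ge_1[of n] sets.sets_into_space[OF E_sets] by (fastforce simp: h_def indicator_def)
    have "(\<lambda>n. measure M (E n)) \<longlonglongrightarrow> 0"
    proof (rule order_tendstoI)
      fix e :: real assume "e < 0"
      then show "\<forall>\<^sub>F n in sequentially. e < measure M (E n)"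
        by (intro always_eventually) (auto intro: order.strict_trans2)
    next
      fix e :: real assume e: "e > 0"
      then obtain J where J: "1 / real (Suc J) < e"
        using nat_approx_posE by metis
      \<comment> \<open>Sets of blocks after J have measure below e and the fillers have measure 0,
        so the exceptional indices are actual positions in the first J + 1 blocks, of which there
        are finitely many.\<close>
      have "{n. \<not> measure M (E n) < e} \<subseteq> prod_encode ` (SIGMA j:{..J}. {..<length (L j)})"
      proof
        fix n assume "n \<in> {n. \<not> measure M (E n) < e}"
        then have n: "measure M (E n) \<ge> e" by simp
        obtain j i where ji: "prod_decode n = (j, i)" by force
        have i: "i < length (L j)" and En: "E n = L j ! i"
          using n e by (auto simp: E_def ji split: if_splits)
        have "j \<le> J"
        proof (rule ccontr)
          assume "\<not> j \<le> J"
          then have "measure M (E n) \<le> 1 / (real j + 1)"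
            using L(3)[of j] i En by auto
          also have "\<dots> \<le> 1 / real (Suc J)"
            using \<open>\<not> j \<le> J\<close> by (intro divide_left_mono) auto
          finally show False using n J by linarith
        qed
        moreover have "n = prod_encode (j, i)"
          by (metis ji prod_decode_inverse)
        ultimately show "n \<in> prod_encode ` (SIGMA j:{..J}. {..<length (L j)})"
          using i by auto
      qed
      then have "finite {n. \<not> measure M (E n) < e}"
        by (rule finite_subset) auto
      then show "\<forall>\<^sub>F n in sequentially. measure M (E n) < e"
        by (simp add: eventually_cofinite flip: cofinite_eq_sequentially)
    qed
    then have "(\<lambda>n. ennreal (measure M (E n))) \<longlonglongrightarrow> ennreal 0"
      by (intro tendsto_ennrealI)
    then show "(\<lambda>n. emeasure M {x \<in> space M. h n x \<noteq> 0}) \<longlonglongrightarrow> 0"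
      by (simp add: supp emeasure_eq_measure2 E_fm)
    show "\<not> (\<lambda>n. h n x) \<longlonglongrightarrow> 0" if x: "x \<in> W" for x
    proof
      assume "(\<lambda>n. h n x) \<longlonglongrightarrow> 0"
      then have "\<forall>\<^sub>F n in sequentially. h n x < 1"
        by (rule order_tendstoD) simp
      then obtain N where N: "\<And>n. n \<ge> N \<Longrightarrow> h n x < 1"
        by (auto simp: eventually_sequentially)
      obtain i where "x \<in> E (prod_encode (N, i))"
        using E_cover[OF x] by blast
      then have "h (prod_encode (N, i)) x \<ge> 1"
        using c_ge_1 by (simp add: h_def)
      then show False
        using N[OF le_prod_encode_1] by (simp add: not_less[symmetric])
    qed
    fix q :: real and A assume q: "q > 0" and A [measurable]: "A \<in> sets M" and AW: "A \<subseteq> W"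
      and pos: "emeasure M A > 0"
    have A_fm: "A \<in> fmeasurable M"
      using W(1) AW A by (rule fmeasurableI2)
    have A_pos: "measure M A > 0"
      using pos by (simp add: emeasure_eq_measure2 A_fm)
    have int: "(\<integral>\<^sup>+x\<in>A. ennreal (\<bar>h n x\<bar> powr q) \<partial>M) = ennreal (c n powr q * measure M (E n \<inter> A))" for n
    proof -
      have "(\<integral>\<^sup>+x\<in>A. ennreal (\<bar>h n x\<bar> powr q) \<partial>M) = (\<integral>\<^sup>+x. ennreal (c n powr q) * indicator (E n \<inter> A) x \<partial>M)"
        using c_ge_1[of n] q by (intro nn_integral_cong) (auto simp: h_def indicator_def)
      also have "\<dots> = ennreal (c n powr q) * emeasure M (E n \<inter> A)"
        by (rule nn_integral_cmult_indicator) measurable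
      also have "emeasure M (E n \<inter> A) = ennreal (measure M (E n \<inter> A))"
        using E_fm A by (intro emeasure_eq_measure2 fmeasurable_Int_fmeasurable)
      finally show ?thesis by (simp add: ennreal_mult)
    qed
    show "\<not> (\<lambda>n. \<integral>\<^sup>+x\<in>A. ennreal (\<bar>h n x\<bar> powr q) \<partial>M) \<longlonglongrightarrow> 0"
    proof
      assume "(\<lambda>n. \<integral>\<^sup>+x\<in>A. ennreal (\<bar>h n x\<bar> powr q) \<partial>M) \<longlonglongrightarrow> 0"
      then have "\<forall>\<^sub>F n in sequentially. (\<integral>\<^sup>+x\<in>A. ennreal (\<bar>h n x\<bar> powr q) \<partial>M) < ennreal (measure M A)"
        by (rule order_tendstoD) (simp add: A_pos)
      then obtain N where N: "\<And>n. n \<ge> N \<Longrightarrow> c n powr q * measure M (E n \<inter> A) < measure M A"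
        by (auto simp: eventually_sequentially int ennreal_less_iff)
      have "\<forall>\<^sub>F m in sequentially. exp (q * real m) \<ge> real m"
        using q by real_asymp
      then obtain N' where N': "\<And>m. m \<ge> N' \<Longrightarrow> exp (q * real m) \<ge> real m"
        by (auto simp: eventually_sequentially)
      \<comment> \<open>As \<open>prod_encode (j, i)\<close> is at least j, the bound N puts the
        whole block into the range where the integrals are small. The bound N' makes the q-th power
        of the height at least j l, and j \<ge> 1 makes this at least l, the length of the
        block.\<close>
      define j where "j = Suc (max N N')"
      define l where "l = length (L j)"
      have "W \<noteq> {}" using W(2) by auto
      then have l: "l > 0"
        using E_cover[of _ j] by (auto simp: l_def)
      have cj: "c (prod_encode (j, i)) powr q = exp (q * real (j * l))" for i
        by (simp add: c_def powr_def l_def)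
      have cover: "A \<subseteq> (\<Union>i<l. E (prod_encode (j, i)) \<inter> A)"
        using E_cover[of _ j] AW unfolding l_def by blast
      have "real l \<le> real (j * l)"
        by (simp add: j_def)
      also have "\<dots> \<le> exp (q * real (j * l))"
      proof (rule N')
        have "N' \<le> j * 1" by (simp add: j_def)
        also have "\<dots> \<le> j * l" using l by (intro mult_left_mono) auto
        finally show "N' \<le> j * l" .
      qed
      finally have "real l * measure M A \<le> exp (q * real (j * l)) * measure M A"
        using A_pos by (intro mult_right_mono) auto
      also have "measure M A \<le> measure M (\<Union>i<l. E (prod_encode (j, i)) \<inter> A)"
        using A E_fm cover by (intro measure_mono_fmeasurable fmeasurable.finite_UN fmeasurable_Int_fmeasurable) auto
      also have "\<dots> \<le> (\<Sum>i<l. measure M (E (prod_encode (j, i)) \<inter> A))"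
        using A_fm E_sets by (intro measure_UNION_le) auto
      finally have "real l * measure M A \<le> exp (q * real (j * l)) * (\<Sum>i<l. measure M (E (prod_encode (j, i)) \<inter> A))"
        by simp
      also have "\<dots> = (\<Sum>i<l. c (prod_encode (j, i)) powr q * measure M (E (prod_encode (j, i)) \<inter> A))"
        by (simp only: cj sum_distrib_left)
      also have "\<dots> < (\<Sum>i<l. measure M A)"
      proof (intro sum_strict_mono N)
        show "N \<le> prod_encode (j, i)" for i
          using le_prod_encode_1[of j i] by (simp add: j_def)
      qed (use l in auto)
      finally show False by simp
    qed
  qed
  then show ?thesis by (rule that)
qed

section \<open>Sequences of classes and their representatives\<close>

lemma seq_class_eq_iff:
  assumes "\<And>n. f n \<in> borel_measurable M" "\<And>n. g n \<in> borel_measurable M"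
  shows "seq_class M f = seq_class M g \<longleftrightarrow> (AE x in M. \<forall>n. f n x = g n x)"
  using assms by (simp add: seq_class_def fun_eq_iff ae_class_eq_iff AE_all_countable)

lemma carrier_L0_seq: "carrier (L0_seq M) = seq_class M ` {f. \<forall>n. f n \<in> borel_measurable M}"
proof (intro equalityI subsetI)
  fix F assume "F \<in> carrier (L0_seq M)"
  then have "\<forall>n. \<exists>f. f \<in> borel_measurable M \<and> F n = ae_class M f"
    by (auto simp: seq_module_def carrier_L0 image_iff)
  then obtain f where "\<forall>n. f n \<in> borel_measurable M \<and> F n = ae_class M (f n)"
    by metis
  then show "F \<in> seq_class M ` {f. \<forall>n. f n \<in> borel_measurable M}"
    by (intro image_eqI[of _ _ f]) (auto simp: seq_class_def)
qed (auto simp: seq_module_def seq_class_def)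

lemma seq_class_add:
  assumes "\<And>n. f n \<in> borel_measurable M" "\<And>n. g n \<in> borel_measurable M"
  shows "seq_class M f \<oplus>\<^bsub>L0_seq M\<^esub> seq_class M g = seq_class M (\<lambda>n x. f n x + g n x)"
  using assms by (simp add: seq_module_def seq_class_def L0_add)

lemma seq_class_smult:
  assumes "\<And>n. f n \<in> borel_measurable M"
  shows "c \<odot>\<^bsub>L0_seq M\<^esub> seq_class M f = seq_class M (\<lambda>n x. c * f n x)"
  using assms by (simp add: seq_module_def seq_class_def L0_smult)

lemma seq_class_zero: "\<zero>\<^bsub>L0_seq M\<^esub> = seq_class M (\<lambda>n x. 0)"
  by (simp add: seq_module_def seq_class_def L0_zero)

text \<open>By definition, membership only asks for some convergent representative. Two
  representatives agree for all n outside a single null set, so convergence passes from one to the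
  other.\<close>

lemma seq_class_in_S_p_iff:
  assumes f: "\<And>n. f n \<in> borel_measurable M"
  shows "seq_class M f \<in> S_p M \<longleftrightarrow> (AE x in M. (\<lambda>n. f n x) \<longlonglongrightarrow> 0)"
proof
  assume "seq_class M f \<in> S_p M"
  then obtain g where g: "\<And>n. g n \<in> borel_measurable M" "AE x in M. (\<lambda>n. g n x) \<longlonglongrightarrow> 0"
    and eq: "seq_class M f = seq_class M g"
    unfolding S_p_def by blast
  have "AE x in M. \<forall>n. f n x = g n x"
    using eq seq_class_eq_iff[OF f g(1)] by simp
  with g(2) show "AE x in M. (\<lambda>n. f n x) \<longlonglongrightarrow> 0"
    by eventually_elim simp
qed (use f in \<open>auto simp: S_p_def\<close>)

lemma seq_class_in_S_L_iff:
  assumes f: "\<And>n. f n \<in> borel_measurable M"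
  shows "seq_class M f \<in> S_L M q \<longleftrightarrow> (\<lambda>n. \<integral>\<^sup>+x. ennreal (\<bar>f n x\<bar> powr q) \<partial>M) \<longlonglongrightarrow> 0"
proof
  assume "seq_class M f \<in> S_L M q"
  then obtain g where g: "\<And>n. g n \<in> borel_measurable M"
      "(\<lambda>n. \<integral>\<^sup>+x. ennreal (\<bar>g n x\<bar> powr q) \<partial>M) \<longlonglongrightarrow> 0"
    and eq: "seq_class M f = seq_class M g"
    unfolding S_L_def by blast
  have "AE x in M. \<forall>n. f n x = g n x"
    using eq seq_class_eq_iff[OF f g(1)] by simp
  then have "(\<integral>\<^sup>+x. ennreal (\<bar>f n x\<bar> powr q) \<partial>M) = (\<integral>\<^sup>+x. ennreal (\<bar>g n x\<bar> powr q) \<partial>M)" for n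
    by (intro nn_integral_cong_AE) (auto elim: eventually_mono)
  then show "(\<lambda>n. \<integral>\<^sup>+x. ennreal (\<bar>f n x\<bar> powr q) \<partial>M) \<longlonglongrightarrow> 0"
    using g(2) by simp
qed (use f in \<open>auto simp: S_L_def\<close>)

context typewriter
begin

text \<open>All the convergence notions involved ignore finitely many terms, so only the tail of g
  has to be a multiple of h. This covers both the exact multiples and their perturbations by
  eventually zero sequences.\<close>

lemma seq_class_mem:
  assumes g [measurable]: "\<And>n. g n \<in> borel_measurable M" and \<phi> [measurable]: "\<phi> \<in> borel_measurable M"
    and tail: "\<And>n x. n \<ge> N \<Longrightarrow> g n x = \<phi> x * h n x"
    and nonzero: "\<not> (AE x in M. x \<in> W \<longrightarrow> \<phi> x = 0)"
  shows "seq_class M g \<in> S_m M - (S_p M \<union> (\<Union>q\<in>{0<..}. S_L M q))"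
proof -
  have W_sets [measurable]: "W \<in> sets M" using W by auto
  have "seq_class M g \<in> S_m M"
    unfolding S_m_def
  proof (intro imageI CollectI conjI allI impI g)
    fix e :: real assume "e > 0"
    \<comment> \<open>Where g n exceeds e > 0 the factor h n cannot vanish, so the shrinking
      supports of h give the bound without any control of \<phi>.\<close>
    have "\<forall>\<^sub>F n in sequentially. emeasure M {x \<in> space M. \<bar>g n x\<bar> > e} \<le> emeasure M {x \<in> space M. h n x \<noteq> 0}"
      unfolding eventually_sequentially
    proof (intro exI[of _ N] allI impI)
      fix n assume n: "N \<le> n"
      show "emeasure M {x \<in> space M. \<bar>g n x\<bar> > e} \<le> emeasure M {x \<in> space M. h n x \<noteq> 0}"
      proof (rule emeasure_mono)
        show "{x \<in> space M. \<bar>g n x\<bar> > e} \<subseteq> {x \<in> space M. h n x \<noteq> 0}"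
          using \<open>e > 0\<close> n by (auto simp: tail)
      qed measurable
    qed
    then show "(\<lambda>n. emeasure M {x \<in> space M. \<bar>g n x\<bar> > e}) \<longlonglongrightarrow> 0"
      by (rule tendsto_sandwich[OF _ _ tendsto_const h_support, rotated]) simp
  qed
  moreover have "seq_class M g \<notin> S_p M"
  proof
    assume "seq_class M g \<in> S_p M"
    then have "AE x in M. (\<lambda>n. g n x) \<longlonglongrightarrow> 0"
      by (simp add: seq_class_in_S_p_iff)
    then have "AE x in M. x \<in> W \<longrightarrow> \<phi> x = 0"
    proof eventually_elim
      case (elim x)
      show ?case
      proof (intro impI, rule ccontr)
        assume x: "x \<in> W" "\<phi> x \<noteq> 0"
        have "\<forall>\<^sub>F n in sequentially. g n x = \<phi> x * h n x"
          using tail by (auto simp: eventually_sequentially)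
        with elim have "(\<lambda>n. \<phi> x * h n x) \<longlonglongrightarrow> 0"
          by (simp cong: tendsto_cong)
        then have "(\<lambda>n. h n x) \<longlonglongrightarrow> 0"
          using tendsto_mult_left_iff[OF x(2), of "\<lambda>n. h n x" 0] by simp
        then show False using h_not_tendsto[OF x(1)] by contradiction
      qed
    qed
    then show False using nonzero by contradiction
  qed
  moreover have "seq_class M g \<notin> S_L M q" if q: "q > 0" for q
  proof
    \<comment> \<open>On \<open>A k\<close>, the function h n is at most (k + 1) times |g n|.
      Convergence of g in L_q would therefore force convergence of h in L_q on \<open>A k\<close>,
      which \<open>h_not_L\<close> permits only if \<open>A k\<close> is null. The sets
      \<open>A k\<close> exhaust the part of W where \<phi> is nonzero.\<close>
    define A where "A k = {x \<in> space M. x \<in> W \<and> \<bar>\<phi> x\<bar> \<ge> 1 / real (Suc k)}" for k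
    have A [measurable]: "A k \<in> sets M" for k
      unfolding A_def by measurable
    assume "seq_class M g \<in> S_L M q"
    then have lim: "(\<lambda>n. \<integral>\<^sup>+x. ennreal (\<bar>g n x\<bar> powr q) \<partial>M) \<longlonglongrightarrow> 0"
      by (simp add: seq_class_in_S_L_iff)
    have "A k \<in> null_sets M" for k
    proof (rule ccontr)
      assume "A k \<notin> null_sets M"
      then have pos: "emeasure M (A k) > 0"
        by (simp add: null_sets_def zero_less_iff_neq_zero)
      define d where "d = 1 / real (Suc k)"
      have d: "d > 0" by (simp add: d_def)
      have bound: "(\<integral>\<^sup>+x\<in>A k. ennreal (\<bar>h n x\<bar> powr q) \<partial>M)
          \<le> ennreal ((1 / d) powr q) * (\<integral>\<^sup>+x. ennreal (\<bar>g n x\<bar> powr q) \<partial>M)" if n: "n \<ge> N" for n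
      proof -
        have "ennreal (\<bar>h n x\<bar> powr q) * indicator (A k) x \<le> ennreal ((1 / d) powr q) * ennreal (\<bar>g n x\<bar> powr q)" for x
        proof (cases "x \<in> A k")
          case True
          then have "d \<le> \<bar>\<phi> x\<bar>" by (simp add: A_def d_def)
          then have "\<bar>h n x\<bar> \<le> (1 / d) * \<bar>g n x\<bar>"
            using d n mult_right_mono[of d "\<bar>\<phi> x\<bar>" "\<bar>h n x\<bar>"] by (simp add: tail abs_mult field_simps)
          then have "\<bar>h n x\<bar> powr q \<le> ((1 / d) * \<bar>g n x\<bar>) powr q"
            using q by (intro powr_mono2) auto
          also have "\<dots> = (1 / d) powr q * \<bar>g n x\<bar> powr q"
            using d by (intro powr_mult)
          finally show ?thesis
            using True by (simp flip: ennreal_mult'')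
        qed simp
        then show ?thesis
          by (subst nn_integral_cmult[symmetric]) (auto intro!: nn_integral_mono)
      qed
      have "(\<lambda>n. ennreal ((1 / d) powr q) * (\<integral>\<^sup>+x. ennreal (\<bar>g n x\<bar> powr q) \<partial>M)) \<longlonglongrightarrow> ennreal ((1 / d) powr q) * 0"
        using lim by (intro ennreal_tendsto_cmult) auto
      then have lim': "(\<lambda>n. ennreal ((1 / d) powr q) * (\<integral>\<^sup>+x. ennreal (\<bar>g n x\<bar> powr q) \<partial>M)) \<longlonglongrightarrow> 0"
        by simp
      have "(\<lambda>n. \<integral>\<^sup>+x\<in>A k. ennreal (\<bar>h n x\<bar> powr q) \<partial>M) \<longlonglongrightarrow> 0"
        using bound by (intro tendsto_sandwich[OF _ _ tendsto_const lim']) (auto simp: eventually_sequentially)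
      then show False
        using h_not_L[OF q A _ pos] by (auto simp: A_def)
    qed
    then have "AE x in M. \<forall>k. x \<notin> A k"
      by (simp add: AE_all_countable AE_not_in)
    then have "AE x in M. x \<in> W \<longrightarrow> \<phi> x = 0"
      using AE_space
    proof eventually_elim
      case (elim x)
      show ?case
      proof (intro impI, rule ccontr)
        assume x: "x \<in> W" "\<phi> x \<noteq> 0"
        then obtain k where "1 / real (Suc k) < \<bar>\<phi> x\<bar>"
          using nat_approx_posE[of "\<bar>\<phi> x\<bar>"] by auto
        then show False using elim x by (auto simp: A_def not_le dest: spec[of _ k])
      qed
    qed
    then show False using nonzero by contradiction
  qed
  ultimately show ?thesis by auto
qed

end


section \<open>Multiples of a typewriter sequence\<close>

definition loc_dist :: "'a measure \<Rightarrow> 'a set \<Rightarrow> ('a \<Rightarrow> real) \<Rightarrow> ('a \<Rightarrow> real) \<Rightarrow> ennreal" where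
  "loc_dist M K f g = (\<integral>\<^sup>+x\<in>K. ennreal (min 1 \<bar>f x - g x\<bar>) \<partial>M)"

lemma loc_dist_commute: "loc_dist M K f g = loc_dist M K g f"
  by (simp add: loc_dist_def abs_minus_commute)

lemma loc_dist_mono: "K \<subseteq> K' \<Longrightarrow> loc_dist M K f g \<le> loc_dist M K' f g"
  unfolding loc_dist_def by (intro nn_integral_mono) (auto simp: indicator_def)

lemma loc_dist_cong_AE:
  assumes "AE x in M. f x = f' x" "AE x in M. g x = g' x"
  shows "loc_dist M K f g = loc_dist M K f' g'"
  unfolding loc_dist_def
proof (rule nn_integral_cong_AE)
  show "AE x in M. ennreal (min 1 \<bar>f x - g x\<bar>) * indicator K x = ennreal (min 1 \<bar>f' x - g' x\<bar>) * indicator K x"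
    using assms by eventually_elim simp
qed

lemma loc_dist_same [simp]: "loc_dist M K f f = 0"
  by (simp add: loc_dist_def)

text \<open>Truncation at 1 is subadditive. The pointwise hypothesis on p and q is general enough to
  yield the triangle inequality and the continuity of addition.\<close>

lemma loc_dist_add_le:
  assumes [measurable]: "f \<in> borel_measurable M" "g \<in> borel_measurable M" "f' \<in> borel_measurable M"
    "g' \<in> borel_measurable M" "p \<in> borel_measurable M" "q \<in> borel_measurable M" "K \<in> sets M"
    and le: "\<And>x. \<bar>p x - q x\<bar> \<le> \<bar>f x - f' x\<bar> + \<bar>g x - g' x\<bar>"
  shows "loc_dist M K p q \<le> loc_dist M K f f' + loc_dist M K g g'"
proof -
  have "ennreal (min 1 \<bar>p x - q x\<bar>) \<le> ennreal (min 1 \<bar>f x - f' x\<bar>) + ennreal (min 1 \<bar>g x - g' x\<bar>)" for x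
  proof -
    have "min 1 \<bar>p x - q x\<bar> \<le> min 1 \<bar>f x - f' x\<bar> + min 1 \<bar>g x - g' x\<bar>"
      using le[of x] by linarith
    then show ?thesis by (simp flip: ennreal_plus add: ennreal_leI)
  qed
  then have "loc_dist M K p q \<le> (\<integral>\<^sup>+x. ennreal (min 1 \<bar>f x - f' x\<bar>) * indicator K x +
      ennreal (min 1 \<bar>g x - g' x\<bar>) * indicator K x \<partial>M)"
    unfolding loc_dist_def by (intro nn_integral_mono) (auto simp: indicator_def)
  also have "\<dots> = loc_dist M K f f' + loc_dist M K g g'"
    unfolding loc_dist_def by (rule nn_integral_add) measurable
  finally show ?thesis .
qed

lemma loc_dist_triangle:
  assumes "f \<in> borel_measurable M" "g \<in> borel_measurable M" "p \<in> borel_measurable M" "K \<in> sets M"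
  shows "loc_dist M K f p \<le> loc_dist M K f g + loc_dist M K g p"
  using assms by (intro loc_dist_add_le) auto

text \<open>For C \<ge> 1 the constant can be pulled out of the truncation: min 1 (C t) \<le> C min
  1 t for t \<ge> 0.\<close>

lemma loc_dist_mult_le:
  assumes [measurable]: "f \<in> borel_measurable M" "g \<in> borel_measurable M" "K \<in> sets M"
    and c: "\<And>x. \<bar>c x\<bar> \<le> C" "C \<ge> 1"
  shows "loc_dist M K (\<lambda>x. c x * f x) (\<lambda>x. c x * g x) \<le> ennreal C * loc_dist M K f g"
proof -
  have "ennreal (min 1 \<bar>c x * f x - c x * g x\<bar>) \<le> ennreal C * ennreal (min 1 \<bar>f x - g x\<bar>)" for x
  proof -
    have "\<bar>c x * f x - c x * g x\<bar> \<le> C * \<bar>f x - g x\<bar>"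
      using c(1)[of x] by (simp flip: right_diff_distrib add: abs_mult mult_right_mono)
    then have "min 1 \<bar>c x * f x - c x * g x\<bar> \<le> C * min 1 \<bar>f x - g x\<bar>"
      using c(2) by (auto simp: min_def)
    then show ?thesis using c(2) by (simp flip: ennreal_mult add: ennreal_leI)
  qed
  then have "loc_dist M K (\<lambda>x. c x * f x) (\<lambda>x. c x * g x) \<le> (\<integral>\<^sup>+x. ennreal C * (ennreal (min 1 \<bar>f x - g x\<bar>) * indicator K x) \<partial>M)"
    unfolding loc_dist_def by (intro nn_integral_mono) (auto simp: indicator_def)
  also have "\<dots> = ennreal C * loc_dist M K f g"
    unfolding loc_dist_def by (rule nn_integral_cmult) measurable
  finally show ?thesis .
qed

lemma loc_dist_eq_0D:
  assumes [measurable]: "f \<in> borel_measurable M" "g \<in> borel_measurable M" "K \<in> sets M"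
    and "loc_dist M K f g = 0"
  shows "AE x in M. x \<in> K \<longrightarrow> f x = g x"
proof -
  have "AE x in M. ennreal (min 1 \<bar>f x - g x\<bar>) * indicator K x = 0"
    using assms(4) unfolding loc_dist_def by (subst (asm) nn_integral_0_iff_AE) measurable
  then show ?thesis
    by eventually_elim (auto simp: indicator_def min_def split: if_splits)
qed

lemma loc_dist_bound:
  assumes "K \<in> sets M" and "\<And>x. x \<in> K \<Longrightarrow> \<bar>f x - g x\<bar> \<le> C" "C \<ge> 0"
  shows "loc_dist M K f g \<le> ennreal C * emeasure M K"
proof -
  have "loc_dist M K f g \<le> (\<integral>\<^sup>+x. ennreal C * indicator K x \<partial>M)"
    unfolding loc_dist_def using assms(2)
    by (intro nn_integral_mono) (auto simp: indicator_def intro!: ennreal_leI min.coboundedI2)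
  then show ?thesis using assms(1) by (simp add: nn_integral_cmult_indicator)
qed

text \<open>This is dominated convergence: truncation provides the majorant
  \<open>indicator K\<close>, which is integrable because K has finite measure.\<close>

lemma loc_dist_tendsto_0:
  assumes [measurable]: "\<And>i. U i \<in> borel_measurable M" "u \<in> borel_measurable M"
    and K: "K \<in> fmeasurable M" and lim: "\<And>x. x \<in> space M \<Longrightarrow> (\<lambda>i. U i x) \<longlonglongrightarrow> u x"
  shows "(\<lambda>i. loc_dist M K u (U i)) \<longlonglongrightarrow> 0"
proof -
  have K' [measurable]: "K \<in> sets M" using K by auto
  have "(\<lambda>i. \<integral>\<^sup>+x. ennreal (min 1 \<bar>u x - U i x\<bar>) * indicator K x \<partial>M) \<longlonglongrightarrow> (\<integral>\<^sup>+x. 0 \<partial>M)"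
  proof (rule nn_integral_dominated_convergence)
    show "AE x in M. ennreal (min 1 \<bar>u x - U i x\<bar>) * indicator K x \<le> indicator K x" for i
      by (auto simp: indicator_def intro!: AE_I2)
    show "(\<integral>\<^sup>+x. indicator K x \<partial>M) < \<infinity>"
      using K by (simp add: fmeasurable_def)
    show "AE x in M. (\<lambda>i. ennreal (min 1 \<bar>u x - U i x\<bar>) * indicator K x) \<longlonglongrightarrow> 0"
    proof (rule AE_I2)
      fix x assume "x \<in> space M"
      from lim[OF this] have "(\<lambda>i. min 1 \<bar>u x - U i x\<bar>) \<longlonglongrightarrow> min 1 \<bar>u x - u x\<bar>"
        by (intro tendsto_intros)
      then have "(\<lambda>i. ennreal (min 1 \<bar>u x - U i x\<bar>)) \<longlonglongrightarrow> ennreal 0"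
        by (intro tendsto_ennrealI) simp
      then show "(\<lambda>i. ennreal (min 1 \<bar>u x - U i x\<bar>) * indicator K x) \<longlonglongrightarrow> 0"
        by (cases "x \<in> K") auto
    qed
  qed measurable
  then show ?thesis by (simp add: loc_dist_def)
qed

text \<open>In terms of representatives, translated basic neighbourhoods are balls for
  \<open>loc_dist\<close>, so topological questions become estimates of integrals.\<close>

lemma translate_L0_nhd_iff:
  assumes f: "f \<in> borel_measurable M" and g: "g \<in> borel_measurable M"
  shows "ae_class M g \<in> (\<lambda>G. ae_class M f \<oplus>\<^bsub>L0 M\<^esub> G) ` L0_nhd M K e \<longleftrightarrow> loc_dist M K g f < ennreal e"
proof
  assume "ae_class M g \<in> (\<lambda>G. ae_class M f \<oplus>\<^bsub>L0 M\<^esub> G) ` L0_nhd M K e"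
  then obtain p where p: "p \<in> borel_measurable M" and lt: "(\<integral>\<^sup>+x\<in>K. ennreal (min 1 \<bar>p x\<bar>) \<partial>M) < ennreal e"
    and eq: "ae_class M g = ae_class M (\<lambda>x. f x + p x)"
    using f by (auto simp: L0_nhd_def L0_add)
  have "AE x in M. g x = f x + p x"
    using eq f g p by (subst (asm) ae_class_eq_iff) auto
  then have "loc_dist M K g f = loc_dist M K (\<lambda>x. f x + p x) f"
    by (intro loc_dist_cong_AE) auto
  then show "loc_dist M K g f < ennreal e"
    using lt by (simp add: loc_dist_def)
next
  assume "loc_dist M K g f < ennreal e"
  then have "ae_class M (\<lambda>x. g x - f x) \<in> L0_nhd M K e"
    using f g by (simp add: ae_class_in_L0_nhd_iff loc_dist_def)
  moreover have "ae_class M g = ae_class M f \<oplus>\<^bsub>L0 M\<^esub> ae_class M (\<lambda>x. g x - f x)"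
    using f g by (simp add: L0_add)
  ultimately show "ae_class M g \<in> (\<lambda>G. ae_class M f \<oplus>\<^bsub>L0 M\<^esub> G) ` L0_nhd M K e"
    by (rule rev_image_eqI)
qed

section \<open>Neighbourhoods and closures in the sequence space\<close>

lemma openin_L0_translate:
  assumes U: "openin (L0_topology M) U" and F: "F \<in> carrier (L0 M)"
  shows "openin (L0_topology M) ((\<lambda>G. F \<oplus>\<^bsub>L0 M\<^esub> G) ` U)"
  unfolding openin_L0_topology
proof (intro conjI ballI)
  interpret vectorspace class_ring "L0 M" by (rule vectorspace_L0)
  have U_car: "U \<subseteq> carrier (L0 M)" using U by (simp add: openin_L0_topology)
  then show "(\<lambda>G. F \<oplus>\<^bsub>L0 M\<^esub> G) ` U \<subseteq> carrier (L0 M)"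
    using F by auto
  fix H assume "H \<in> (\<lambda>G. F \<oplus>\<^bsub>L0 M\<^esub> G) ` U"
  then obtain G where G: "G \<in> U" "H = F \<oplus>\<^bsub>L0 M\<^esub> G" by blast
  then obtain K e where K: "K \<in> sets M" "e > 0" "emeasure M K < \<infinity>"
      "(\<lambda>G'. G \<oplus>\<^bsub>L0 M\<^esub> G') ` L0_nhd M K e \<subseteq> U"
    using U unfolding openin_L0_topology by blast
  have "H \<oplus>\<^bsub>L0 M\<^esub> G' \<in> (\<lambda>G. F \<oplus>\<^bsub>L0 M\<^esub> G) ` U" if G': "G' \<in> L0_nhd M K e" for G'
  proof -
    have "H \<oplus>\<^bsub>L0 M\<^esub> G' = F \<oplus>\<^bsub>L0 M\<^esub> (G \<oplus>\<^bsub>L0 M\<^esub> G')"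
      using F G U_car G' L0_nhd_subset_carrier[of M K e] by (simp add: a_assoc subset_iff)
    then show ?thesis using K(4) G' by blast
  qed
  then show "\<exists>K\<in>sets M. \<exists>e>0. emeasure M K < \<infinity> \<and> (\<lambda>G'. H \<oplus>\<^bsub>L0 M\<^esub> G') ` L0_nhd M K e \<subseteq> (\<lambda>G. F \<oplus>\<^bsub>L0 M\<^esub> G) ` U"
    using K by blast
qed

text \<open>A basic open set of the product restricts finitely many entries. One K, one e and one N
  suffice for all of them: take the union of the sets K, the least e and a bound for the restricted
  indices.\<close>

lemma seq_class_in_closure_iff:
  assumes f: "\<And>n. f n \<in> borel_measurable M" and V: "V \<subseteq> carrier (L0_seq M)"
  shows "seq_class M f \<in> L0_seq_topology M closure_of V \<longleftrightarrow>
    (\<forall>K\<in>fmeasurable M. \<forall>e>0. \<forall>N. \<exists>g. (\<forall>n. g n \<in> borel_measurable M) \<and> seq_class M g \<in> V \<and>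
      (\<forall>n<N. loc_dist M K (g n) (f n) < ennreal e))"
proof (intro iffI ballI allI impI)
  fix K and e :: real and N :: nat
  assume cl: "seq_class M f \<in> L0_seq_topology M closure_of V"
    and K: "K \<in> fmeasurable M" and e: "e > 0"
  define U where "U n = (if n < N then (\<lambda>G. ae_class M (f n) \<oplus>\<^bsub>L0 M\<^esub> G) ` L0_nhd M K e
    else topspace (L0_topology M))" for n
  have "openin (L0_seq_topology M) (PiE UNIV U)"
  proof (rule product_topology_basis)
    show "openin (L0_topology M) (U n)" for n
      using K f by (auto simp: U_def fmeasurable_def intro!: openin_L0_translate openin_L0_nhd)
    show "finite {n. U n \<noteq> topspace (L0_topology M)}"
      by (rule finite_subset[of _ "{..<N}"]) (auto simp: U_def split: if_splits)
  qed
  moreover have "seq_class M f \<in> PiE UNIV U"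
    using e f by (auto simp: PiE_def Pi_def U_def seq_class_def topspace_L0_topology translate_L0_nhd_iff)
  ultimately obtain G where G: "G \<in> V" "G \<in> PiE UNIV U"
    using cl unfolding in_closure_of by blast
  obtain g where g: "\<And>n. g n \<in> borel_measurable M" "G = seq_class M g"
    using V G(1) by (auto simp: carrier_L0_seq)
  have "loc_dist M K (g n) (f n) < ennreal e" if "n < N" for n
  proof -
    have "ae_class M (g n) \<in> U n"
      using G(2) by (auto simp: g(2) seq_class_def PiE_def Pi_def)
    then show ?thesis
      using that by (simp add: U_def translate_L0_nhd_iff f g(1))
  qed
  then show "\<exists>g. (\<forall>n. g n \<in> borel_measurable M) \<and> seq_class M g \<in> V \<and> (\<forall>n<N. loc_dist M K (g n) (f n) < ennreal e)"
    using g G(1) by blast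
next
  assume approx: "\<forall>K\<in>fmeasurable M. \<forall>e>0. \<forall>N. \<exists>g. (\<forall>n. g n \<in> borel_measurable M) \<and> seq_class M g \<in> V \<and>
      (\<forall>n<N. loc_dist M K (g n) (f n) < ennreal e)"
  show "seq_class M f \<in> L0_seq_topology M closure_of V"
    unfolding in_closure_of
  proof (intro conjI allI impI)
    show "seq_class M f \<in> topspace (L0_seq_topology M)"
      unfolding topspace_L0_seq_topology carrier_L0_seq using f by blast
    fix T assume "seq_class M f \<in> T \<and> openin (L0_seq_topology M) T"
    then obtain U where U: "finite {n. U n \<noteq> topspace (L0_topology M)}"
        "\<And>n. openin (L0_topology M) (U n)" "seq_class M f \<in> PiE UNIV U" "PiE UNIV U \<subseteq> T"
      unfolding openin_product_topology_alt by auto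
    have "\<forall>n. \<exists>K e. K \<in> fmeasurable M \<and> e > 0 \<and> (\<lambda>G. ae_class M (f n) \<oplus>\<^bsub>L0 M\<^esub> G) ` L0_nhd M K e \<subseteq> U n"
    proof
      fix n
      have "ae_class M (f n) \<in> U n"
        using U(3) by (auto simp: seq_class_def PiE_def Pi_def)
      then show "\<exists>K e. K \<in> fmeasurable M \<and> e > 0 \<and> (\<lambda>G. ae_class M (f n) \<oplus>\<^bsub>L0 M\<^esub> G) ` L0_nhd M K e \<subseteq> U n"
        using U(2)[of n] unfolding openin_L0_topology fmeasurable_def by blast
    qed
    then obtain K e where Ke: "\<And>n. K n \<in> fmeasurable M" "\<And>n. e n > (0::real)"
        "\<And>n. (\<lambda>G. ae_class M (f n) \<oplus>\<^bsub>L0 M\<^esub> G) ` L0_nhd M (K n) (e n) \<subseteq> U n"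
      by metis
    obtain N where N: "\<And>n. U n \<noteq> topspace (L0_topology M) \<Longrightarrow> n < N"
      using U(1) finite_nat_set_iff_bounded by auto
    define K' where "K' = (\<Union>n<N. K n)"
    \<comment> \<open>Inserting 1 keeps the minimum defined when N = 0.\<close>
    define e' where "e' = Min (insert 1 (e ` {..<N}))"
    have K': "K' \<in> fmeasurable M"
      unfolding K'_def using Ke(1) by (intro fmeasurable.finite_UN) auto
    have e': "e' > 0" "\<And>n. n < N \<Longrightarrow> e' \<le> e n"
      using Ke(2) by (auto simp: e'_def)
    obtain g where g: "\<And>n. g n \<in> borel_measurable M" "seq_class M g \<in> V"
        "\<And>n. n < N \<Longrightarrow> loc_dist M K' (g n) (f n) < ennreal e'"
      using approx K' e'(1) by blast
    have "ae_class M (g n) \<in> U n" for n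
    proof (cases "n < N")
      case True
      have "loc_dist M (K n) (g n) (f n) \<le> loc_dist M K' (g n) (f n)"
        using True by (intro loc_dist_mono) (auto simp: K'_def)
      also have "\<dots> < ennreal e'" using True by (rule g(3))
      also have "\<dots> \<le> ennreal (e n)" using e'(2)[OF True] by (rule ennreal_leI)
      finally show ?thesis
        by (intro subsetD[OF Ke(3)]) (simp add: translate_L0_nhd_iff f g(1))
    next
      case False
      then have "U n = topspace (L0_topology M)" using N by blast
      then show ?thesis using g(1) by (auto simp: topspace_L0_topology)
    qed
    then have "seq_class M g \<in> T"
      using U(4) by (auto simp: seq_class_def PiE_def Pi_def)
    then show "\<exists>G. G \<in> V \<and> G \<in> T"
      using g(2) by blast
  qed
qed

lemma semifinite_null_setI:
  assumes M: "semifinite M" and A: "A \<in> sets M"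
    and null: "\<And>K. \<lbrakk>K \<in> fmeasurable M; K \<subseteq> A\<rbrakk> \<Longrightarrow> emeasure M K = 0"
  shows "emeasure M A = 0"
proof -
  have "emeasure M A = (SUP B\<in>{B \<in> sets M. B \<subseteq> A \<and> emeasure M B < \<infinity>}. emeasure M B)"
    using M A unfolding semifinite_def by blast
  also have "\<dots> \<le> 0"
    using null by (intro SUP_least) (auto simp: fmeasurable_def)
  finally show ?thesis by simp
qed

text \<open>The topology sees only sets of finite measure. If two functions agree almost everywhere
  on each of these, every finite-measure part of their disagreement set is null, and by
  semifiniteness so is the whole set.\<close>

lemma semifinite_AE_eqI:
  assumes M: "semifinite M" and [measurable]: "f \<in> borel_measurable M" "g \<in> borel_measurable M"
    and dist: "\<And>K. K \<in> fmeasurable M \<Longrightarrow> loc_dist M K f g = 0"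
  shows "AE x in M. f x = g x"
proof -
  have "emeasure M {x \<in> space M. f x \<noteq> g x} = 0"
  proof (rule semifinite_null_setI[OF M])
    fix K assume K: "K \<in> fmeasurable M" "K \<subseteq> {x \<in> space M. f x \<noteq> g x}"
    then have "AE x in M. x \<in> K \<longrightarrow> f x = g x"
      by (intro loc_dist_eq_0D dist) auto
    then have "AE x in M. x \<notin> K"
      using K(2) by (auto elim: eventually_mono)
    then show "emeasure M K = 0"
      using K(1) AE_iff_null_sets[of K M] by auto
  qed measurable
  then show ?thesis
    by (intro AE_I[of _ _ "{x \<in> space M. f x \<noteq> g x}"]) auto
qed

section \<open>The closed subspace of multiples of h\<close>

context typewriter
begin

definition multiples :: "(nat \<Rightarrow> ('a \<Rightarrow> real) set) set" where
  "multiples = (\<lambda>\<phi>. seq_class M (\<lambda>n x. \<phi> x * h n x)) ` borel_measurable M"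

lemma multiples_subset: "multiples \<subseteq> carrier (L0_seq M)"
  by (auto simp: multiples_def carrier_L0_seq)

text \<open>As \<open>h 0\<close> is the indicator function of \<open>W\<close>, a multiple of \<open>h\<close> is characterized by its zeroth
  entry. Multiplication by the bounded function \<open>h n\<close> is continuous, which makes this a closed condition.\<close>

lemma multiples_iff:
  assumes f [measurable]: "\<And>n. f n \<in> borel_measurable M"
  shows "seq_class M f \<in> multiples \<longleftrightarrow> (\<forall>n. AE x in M. f n x = h n x * f 0 x)"
proof
  assume "seq_class M f \<in> multiples"
  then obtain \<phi> where [measurable]: "\<phi> \<in> borel_measurable M"
    and eq: "seq_class M f = seq_class M (\<lambda>n x. \<phi> x * h n x)"
    by (auto simp: multiples_def)
  have "AE x in M. \<forall>n. f n x = \<phi> x * h n x"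
    using eq by (subst (asm) seq_class_eq_iff) measurable
  then have "AE x in M. f n x = h n x * f 0 x" for n
  proof eventually_elim
    case (elim x)
    show ?case
      using h_outside[of x n] by (cases "x \<in> W") (auto simp: elim h_0)
  qed
  then show "\<forall>n. AE x in M. f n x = h n x * f 0 x" ..
next
  assume *: "\<forall>n. AE x in M. f n x = h n x * f 0 x"
  have "seq_class M f = seq_class M (\<lambda>n x. f 0 x * h n x)"
    using * by (subst seq_class_eq_iff) (auto simp: AE_all_countable mult.commute)
  then show "seq_class M f \<in> multiples"
    by (auto simp: multiples_def)
qed

lemma closedin_multiples:
  assumes "semifinite M"
  shows "closedin (L0_seq_topology M) multiples"
proof -
  have "F \<in> multiples" if cl: "F \<in> L0_seq_topology M closure_of multiples" for F
  proof -
    have "F \<in> carrier (L0_seq M)"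
      using cl unfolding in_closure_of topspace_L0_seq_topology by blast
    then obtain f where f [measurable]: "\<And>n. f n \<in> borel_measurable M" and F: "F = seq_class M f"
      by (auto simp: carrier_L0_seq)
    have "AE x in M. f n x = h n x * f 0 x" for n
    proof (rule semifinite_AE_eqI[OF assms])
      fix K assume K: "K \<in> fmeasurable M"
      then have [measurable]: "K \<in> sets M" by auto
      obtain C' where C': "\<And>x. \<bar>h n x\<bar> \<le> C'" using h_bounded by blast
      define C where "C = max 1 C'"
      have C: "\<And>x. \<bar>h n x\<bar> \<le> C" "C \<ge> 1" using C' by (auto simp: C_def le_max_iff_disj)
      have le: "loc_dist M K (f n) (\<lambda>x. h n x * f 0 x) \<le> ennreal e" if e: "e > 0" for e
      proof -
        \<comment> \<open>The error consists of d from entry n and of C d from entry 0 after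
          multiplication by h n; together they make e.\<close>
        define d where "d = e / (1 + C)"
        have d: "d > 0" using e C(2) by (simp add: d_def)
        obtain g where g [measurable]: "\<And>n. g n \<in> borel_measurable M" and mult: "seq_class M g \<in> multiples"
          and close: "\<And>m. m < Suc n \<Longrightarrow> loc_dist M K (g m) (f m) < ennreal d"
          using cl K d unfolding F seq_class_in_closure_iff[OF f multiples_subset] by blast
        have "loc_dist M K (f n) (\<lambda>x. h n x * f 0 x)
            \<le> loc_dist M K (f n) (g n) + loc_dist M K (g n) (\<lambda>x. h n x * f 0 x)"
          by (rule loc_dist_triangle) measurable
        also have "loc_dist M K (g n) (\<lambda>x. h n x * f 0 x) = loc_dist M K (\<lambda>x. h n x * g 0 x) (\<lambda>x. h n x * f 0 x)"
          using mult by (intro loc_dist_cong_AE) (auto simp: multiples_iff)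
        also have "\<dots> \<le> ennreal C * loc_dist M K (g 0) (f 0)"
          by (rule loc_dist_mult_le) (use C in auto)
        also have "loc_dist M K (f n) (g n) + ennreal C * loc_dist M K (g 0) (f 0) \<le> ennreal d + ennreal C * ennreal d"
          using close[of n] close[of 0] by (intro add_mono mult_left_mono) (auto simp: loc_dist_commute)
        also have "\<dots> = ennreal ((1 + C) * d)"
          using d C(2) by (simp add: algebra_simps flip: ennreal_mult ennreal_plus)
        also have "(1 + C) * d = e"
          using C(2) by (simp add: d_def)
        finally show ?thesis by (simp add: add_left_mono)
      qed
      have "loc_dist M K (f n) (\<lambda>x. h n x * f 0 x) \<le> 0"
        by (rule ennreal_le_epsilon) (simp add: le)
      then show "loc_dist M K (f n) (\<lambda>x. h n x * f 0 x) = 0"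
        by simp
    qed measurable
    then show ?thesis
      by (simp add: F multiples_iff)
  qed
  then show ?thesis
    unfolding closure_of_subset_eq[symmetric] topspace_L0_seq_topology using multiples_subset by blast
qed

lemma submodule_multiples: "submodule class_ring multiples (L0_seq M)"
proof -
  interpret vectorspace class_ring "L0_seq M" by (rule vectorspace_L0_seq)
  show ?thesis
  proof
    show "multiples \<subseteq> carrier (L0_seq M)" by (rule multiples_subset)
    show "\<zero>\<^bsub>L0_seq M\<^esub> \<in> multiples"
      unfolding multiples_def by (intro image_eqI[of _ _ "\<lambda>x. 0"]) (auto simp: seq_class_zero)
  next
    fix F G assume "F \<in> multiples" "G \<in> multiples"
    then obtain \<phi> \<psi> where "\<phi> \<in> borel_measurable M" "F = seq_class M (\<lambda>n x. \<phi> x * h n x)"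
        "\<psi> \<in> borel_measurable M" "G = seq_class M (\<lambda>n x. \<psi> x * h n x)"
      unfolding multiples_def by blast
    then show "F \<oplus>\<^bsub>L0_seq M\<^esub> G \<in> multiples"
      unfolding multiples_def
      by (intro image_eqI[of _ _ "\<lambda>x. \<phi> x + \<psi> x"]) (auto simp: seq_class_add distrib_right)
  next
    fix c F assume "F \<in> multiples"
    then obtain \<phi> where "\<phi> \<in> borel_measurable M" "F = seq_class M (\<lambda>n x. \<phi> x * h n x)"
      unfolding multiples_def by blast
    then show "c \<odot>\<^bsub>L0_seq M\<^esub> F \<in> multiples"
      unfolding multiples_def
      by (intro image_eqI[of _ _ "\<lambda>x. c * \<phi> x"]) (auto simp: seq_class_smult mult.assoc)
  qed
qed

lemma multiples_mem:
  assumes "F \<in> multiples - {\<zero>\<^bsub>L0_seq M\<^esub>}"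
  shows "F \<in> S_m M - (S_p M \<union> (\<Union>q\<in>{0<..}. S_L M q))"
proof -
  obtain \<phi> where [measurable]: "\<phi> \<in> borel_measurable M" and F: "F = seq_class M (\<lambda>n x. \<phi> x * h n x)"
    using assms by (auto simp: multiples_def)
  have "\<not> (AE x in M. \<forall>n. \<phi> x * h n x = 0)"
    using assms by (auto simp: F seq_class_zero seq_class_eq_iff)
  \<comment> \<open>The entry n = 0 gives one direction, since \<open>h 0\<close> is 1 on W; all h n
    vanish off W, which gives the other.\<close>
  moreover have "(\<forall>n. \<phi> x * h n x = 0) \<longleftrightarrow> (x \<in> W \<longrightarrow> \<phi> x = 0)" for x
    using h_outside[of x] h_0 by (auto simp: indicator_def fun_eq_iff dest: spec[of _ 0])
  ultimately show ?thesis
    unfolding F by (intro seq_class_mem[where N = 0 and \<phi> = \<phi>]) auto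
qed

end


section \<open>Linearly independent perturbations\<close>

text \<open>This is the nonsingularity of a Vandermonde system. Vanishing power sums give a
  vanishing weighted sum for every polynomial, and the polynomial whose roots are the other points
  of Y isolates the coefficient at y.\<close>

lemma power_sums_eq_0D:
  fixes c :: "real \<Rightarrow> real"
  assumes Y: "finite Y" and sums: "\<And>k. (\<Sum>y\<in>Y. c y * y ^ k) = 0" and y: "y \<in> Y"
  shows "c y = 0"
proof -
  have "(\<Sum>z\<in>Y. c z * poly p z) = 0" for p
  proof -
    have "(\<Sum>z\<in>Y. c z * poly p z) = (\<Sum>z\<in>Y. \<Sum>i\<le>degree p. coeff p i * (c z * z ^ i))"
      by (simp add: poly_altdef sum_distrib_left mult_ac)
    also have "\<dots> = (\<Sum>i\<le>degree p. coeff p i * (\<Sum>z\<in>Y. c z * z ^ i))"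
      by (subst sum.swap) (simp add: sum_distrib_left)
    finally show ?thesis by (simp add: sums)
  qed
  from this[of "\<Prod>z\<in>Y - {y}. [:- z, 1:]"]
  have "0 = (\<Sum>z\<in>Y. c z * (\<Prod>w\<in>Y - {y}. z - w))"
    by (simp add: poly_prod)
  also have "\<dots> = c y * (\<Prod>w\<in>Y - {y}. y - w)"
    using Y y by (subst sum.remove[OF Y y]) (auto intro!: sum.neutral prod_zero)
  finally show ?thesis
    using Y by (auto simp: prod_zero_iff)
qed

lemma lincomb_seq_class:
  assumes "\<And>i n. i \<in> I \<Longrightarrow> g i n \<in> borel_measurable M" and "finite I"
  shows "(\<Oplus>\<^bsub>L0_seq M\<^esub>i\<in>I. c i \<odot>\<^bsub>L0_seq M\<^esub> seq_class M (g i)) = seq_class M (\<lambda>n x. \<Sum>i\<in>I. c i * g i n x)"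
  using assms(2,1)
proof (induction rule: finite_induct)
  interpret vectorspace class_ring "L0_seq M" by (rule vectorspace_L0_seq)
  case empty
  then show ?case by (simp add: seq_class_zero)
next
  interpret vectorspace class_ring "L0_seq M" by (rule vectorspace_L0_seq)
  case (insert i I)
  have car: "c j \<odot>\<^bsub>L0_seq M\<^esub> seq_class M (g j) \<in> carrier (L0_seq M)" if "j \<in> insert i I" for j
    using insert.prems[OF that] by (auto simp: seq_class_smult carrier_L0_seq)
  have "(\<Oplus>\<^bsub>L0_seq M\<^esub>j\<in>insert i I. c j \<odot>\<^bsub>L0_seq M\<^esub> seq_class M (g j)) =
      c i \<odot>\<^bsub>L0_seq M\<^esub> seq_class M (g i) \<oplus>\<^bsub>L0_seq M\<^esub> (\<Oplus>\<^bsub>L0_seq M\<^esub>j\<in>I. c j \<odot>\<^bsub>L0_seq M\<^esub> seq_class M (g j))"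
    using insert.hyps car by (intro finsum_insert) auto
  also have "\<dots> = c i \<odot>\<^bsub>L0_seq M\<^esub> seq_class M (g i) \<oplus>\<^bsub>L0_seq M\<^esub> seq_class M (\<lambda>n x. \<Sum>j\<in>I. c j * g j n x)"
    using insert by simp
  also have "\<dots> = seq_class M (\<lambda>n x. \<Sum>j\<in>insert i I. c j * g j n x)"
    using insert.prems insert.hyps by (subst seq_class_smult) (auto simp: seq_class_add)
  finally show ?case .
qed

locale indexed_typewriter = typewriter +
  fixes \<kappa> :: "'a \<Rightarrow> nat"
  assumes measurable_\<kappa> [measurable]: "\<kappa> \<in> measurable M (count_space UNIV)"
    and \<kappa>_pos: "\<And>k. emeasure M {x \<in> space M. x \<in> W \<and> \<kappa> x = k} > 0"
begin

text \<open>The exponent \<open>\<kappa> x + 1\<close> makes the perturbation by \<open>h\<close> small for small \<open>y\<close>.\<close>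

definition pvec :: "(real \<Rightarrow> nat \<Rightarrow> 'a \<Rightarrow> real) \<Rightarrow> real \<Rightarrow> nat \<Rightarrow> 'a \<Rightarrow> real" where
  "pvec d y n x = d y n x + y ^ Suc (\<kappa> x) * h n x"

lemma pvec_measurable [measurable]:
  assumes [measurable]: "\<And>y n. d y n \<in> borel_measurable M"
  shows "pvec d y n \<in> borel_measurable M"
proof -
  have [measurable]: "(\<lambda>x. y ^ Suc (\<kappa> x)) \<in> borel_measurable M"
    by (rule measurable_compose[OF measurable_\<kappa>, where g = "\<lambda>k. y ^ Suc k"]) simp
  show ?thesis unfolding pvec_def by measurable
qed

text \<open>Beyond all the thresholds of the finitely many sequences d y, the combination equals
  p(\<kappa>) h. Some p k is nonzero by the Vandermonde argument, and the fibre of \<kappa> over k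
  is not null.\<close>

lemma lincomb_pvec_mem:
  assumes d [measurable]: "\<And>y n. d y n \<in> borel_measurable M"
    and tail: "\<And>y. \<exists>N. \<forall>n\<ge>N. \<forall>x. d y n x = 0"
    and Y: "finite Y" "Y \<subseteq> {0<..}" and nz: "y \<in> Y" "c y \<noteq> 0"
  shows "seq_class M (\<lambda>n x. \<Sum>y\<in>Y. c y * pvec d y n x) \<in> S_m M - (S_p M \<union> (\<Union>q\<in>{0<..}. S_L M q))"
proof -
  obtain N where N: "\<And>y n x. n \<ge> N y \<Longrightarrow> d y n x = 0"
    using tail by metis
  define p where "p k = (\<Sum>y\<in>Y. c y * y ^ Suc k)" for k
  have "\<exists>k. p k \<noteq> 0"
  proof (rule ccontr)
    assume "\<nexists>k. p k \<noteq> 0"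
    \<comment> \<open>One factor y moves into the coefficient so that the exponents start at 0. It
      can be cancelled afterwards because Y consists of positive numbers.\<close>
    then have "(\<Sum>y\<in>Y. (c y * y) * y ^ k) = 0" for k
      unfolding p_def by (auto simp: mult.assoc)
    then have "c y * y = 0"
      using power_sums_eq_0D[of Y "\<lambda>y. c y * y"] Y nz by blast
    then show False using nz Y by auto
  qed
  then obtain k where k: "p k \<noteq> 0" by blast
  show ?thesis
  proof (rule seq_class_mem[where \<phi> = "\<lambda>x. p (\<kappa> x)" and N = "Max (N ` Y)"])
    show "(\<lambda>x. \<Sum>y\<in>Y. c y * pvec d y n x) \<in> borel_measurable M" for n
      by measurable
    show "(\<lambda>x. p (\<kappa> x)) \<in> borel_measurable M"
      by (rule measurable_compose[OF measurable_\<kappa>]) simp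
  next
    fix n x assume n: "Max (N ` Y) \<le> n"
    have "d y n x = 0" if "y \<in> Y" for y
      using that Y by (intro N order.trans[OF Max_ge n]) auto
    then show "(\<Sum>y\<in>Y. c y * pvec d y n x) = p (\<kappa> x) * h n x"
      by (simp add: pvec_def p_def sum_distrib_right mult.assoc)
  next
    show "\<not> (AE x in M. x \<in> W \<longrightarrow> p (\<kappa> x) = 0)"
    proof
      have [measurable]: "W \<in> sets M" using W by auto
      assume "AE x in M. x \<in> W \<longrightarrow> p (\<kappa> x) = 0"
      then have "AE x in M. x \<notin> {x \<in> space M. x \<in> W \<and> \<kappa> x = k}"
        by eventually_elim (use k in auto)
      then have "emeasure M {x \<in> space M. x \<in> W \<and> \<kappa> x = k} = 0"
        by (subst (asm) AE_iff_null_sets[symmetric]) (auto simp: null_sets_def)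
      then show False using \<kappa>_pos[of k] by simp
    qed
  qed
qed

text \<open>The index \<open>y\<close> is determined by the vector, since otherwise the difference of two vectors would
  be a nontrivial combination that vanishes, and the zero sequence converges pointwise.\<close>

lemma pvec_span:
  fixes d
  defines "B \<equiv> (\<lambda>y. seq_class M (pvec d y)) ` {0<..<1}"
  assumes d [measurable]: "\<And>y n. d y n \<in> borel_measurable M"
    and tail: "\<And>y. \<exists>N. \<forall>n\<ge>N. \<forall>x. d y n x = 0"
  shows "B \<subseteq> carrier (L0_seq M)"
    and "inj_on (\<lambda>y. seq_class M (pvec d y)) {0<..<1}"
    and "\<not> LinearCombinations.module.lin_dep class_ring (L0_seq M) B"
    and "LinearCombinations.module.span class_ring (L0_seq M) B - {\<zero>\<^bsub>L0_seq M\<^esub>}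
      \<subseteq> S_m M - (S_p M \<union> (\<Union>q\<in>{0<..}. S_L M q))"
proof -
  interpret vectorspace class_ring "L0_seq M" by (rule vectorspace_L0_seq)
  let ?b = "\<lambda>y. seq_class M (pvec d y)"
  have b_car: "?b y \<in> carrier (L0_seq M)" for y
    unfolding carrier_L0_seq by auto
  show B: "B \<subseteq> carrier (L0_seq M)"
    unfolding B_def using b_car by blast
  have zero: "\<zero>\<^bsub>L0_seq M\<^esub> \<in> S_p M"
    unfolding seq_class_zero by (subst seq_class_in_S_p_iff) auto
  show inj: "inj_on ?b {0<..<1}"
  proof (rule inj_onI, rule ccontr)
    fix y z :: real assume yz: "y \<in> {0<..<1}" "z \<in> {0<..<1}" "?b y = ?b z" "y \<noteq> z"
    define c :: "real \<Rightarrow> real" where "c w = (if w = y then 1 else - 1)" for w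
    have "AE x in M. \<forall>n. pvec d y n x = pvec d z n x"
      using yz(3) by (subst (asm) seq_class_eq_iff) measurable
    then have "AE x in M. \<forall>n. (\<Sum>w\<in>{y, z}. c w * pvec d w n x) = 0"
      using yz(4) by (auto simp: c_def elim: eventually_mono)
    then have "seq_class M (\<lambda>n x. \<Sum>w\<in>{y, z}. c w * pvec d w n x) = \<zero>\<^bsub>L0_seq M\<^esub>"
      unfolding seq_class_zero by (subst seq_class_eq_iff) measurable
    moreover have "seq_class M (\<lambda>n x. \<Sum>w\<in>{y, z}. c w * pvec d w n x) \<in> S_m M - (S_p M \<union> (\<Union>q\<in>{0<..}. S_L M q))"
      by (rule lincomb_pvec_mem[OF d tail, where y = y]) (use yz in \<open>auto simp: c_def\<close>)
    ultimately show False using zero by auto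
  qed
  \<comment> \<open>This gives both remaining claims: a combination with a nonzero coefficient
    avoids \<open>S_p M\<close>, hence is not the zero vector.\<close>
  have lincomb: "lincomb a A \<in> S_m M - (S_p M \<union> (\<Union>q\<in>{0<..}. S_L M q))"
    if A: "finite A" "A \<subseteq> B" and v: "v \<in> A" "a v \<noteq> 0" for a A v
  proof -
    obtain Y where Y: "Y \<subseteq> {0<..<1}" "A = ?b ` Y"
      using A(2) unfolding B_def by (metis subset_imageE)
    have inj_Y: "inj_on ?b Y" using inj Y(1) by (rule inj_on_subset)
    have fin: "finite Y" using A(1) Y(2) inj_Y by (simp add: finite_image_iff)
    have "lincomb a A = (\<Oplus>\<^bsub>L0_seq M\<^esub>v\<in>?b ` Y. a v \<odot>\<^bsub>L0_seq M\<^esub> v)"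
      by (simp add: lincomb_def Y(2))
    also have "\<dots> = (\<Oplus>\<^bsub>L0_seq M\<^esub>y\<in>Y. a (?b y) \<odot>\<^bsub>L0_seq M\<^esub> ?b y)"
      using inj_Y b_car by (intro finsum_reindex) auto
    also have "\<dots> = seq_class M (\<lambda>n x. \<Sum>y\<in>Y. a (?b y) * pvec d y n x)"
      using fin by (intro lincomb_seq_class) measurable
    also have "\<dots> \<in> S_m M - (S_p M \<union> (\<Union>q\<in>{0<..}. S_L M q))"
    proof -
      obtain y where "y \<in> Y" "a (?b y) \<noteq> 0" using v Y(2) by blast
      then show ?thesis
        using Y(1) fin by (intro lincomb_pvec_mem[OF d tail, where y = y]) auto
    qed
    finally show ?thesis .
  qed
  show "\<not> lin_dep B"
    using lincomb zero unfolding lin_dep_def by fastforce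
  show "span B - {\<zero>\<^bsub>L0_seq M\<^esub>} \<subseteq> S_m M - (S_p M \<union> (\<Union>q\<in>{0<..}. S_L M q))"
  proof
    fix F assume F: "F \<in> span B - {\<zero>\<^bsub>L0_seq M\<^esub>}"
    then obtain a A where A: "finite A" "A \<subseteq> B" and Fa: "F = lincomb a A"
      unfolding span_def by blast
    have "\<exists>v\<in>A. a v \<noteq> 0"
    proof (rule ccontr)
      assume "\<not> (\<exists>v\<in>A. a v \<noteq> 0)"
      then have "F = (\<Oplus>\<^bsub>L0_seq M\<^esub>v\<in>A. \<zero>\<^bsub>L0_seq M\<^esub>)"
        unfolding Fa lincomb_def using A(2) B lmult_0 by (intro finsum_cong') auto
      then show False using F by simp
    qed
    then show "F \<in> S_m M - (S_p M \<union> (\<Union>q\<in>{0<..}. S_L M q))"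
      using lincomb[OF A] Fa by blast
  qed
qed

end


section \<open>Spaceability and dense lineability\<close>

lemma separable_loc_dist:
  assumes sub: "\<A> \<subseteq> sets M" and cnt: "countable \<A>"
    and approx: "\<And>A e. \<lbrakk>A \<in> fmeasurable M; e > (0::real)\<rbrakk> \<Longrightarrow>
      \<exists>A0\<in>\<A>. emeasure M ((A - A0) \<union> (A0 - A)) < ennreal e"
  obtains S where "countable S" "S \<subseteq> borel_measurable M"
    "\<And>f K e. \<lbrakk>f \<in> borel_measurable M; K \<in> fmeasurable M; e > (0::real)\<rbrakk> \<Longrightarrow> \<exists>s\<in>S. loc_dist M K s f < ennreal e"
proof -
  define comb :: "(rat \<times> 'a set) list \<Rightarrow> 'a \<Rightarrow> real"
    where "comb l x = (\<Sum>(q, A)\<leftarrow>l. of_rat q * indicator A x)" for l x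
  define S where "S = comb ` lists (UNIV \<times> \<A>)"
  have comb_meas: "comb l \<in> borel_measurable M" if "l \<in> lists (UNIV \<times> \<A>)" for l
    using that
  proof (induction l)
    case (Cons p l)
    obtain q A where p: "p = (q, A)" by force
    have A: "A \<in> sets M" using Cons.hyps sub by (auto simp: p)
    have "comb (p # l) = (\<lambda>x. of_rat q * indicator A x + comb l x)"
      by (simp add: comb_def p fun_eq_iff)
    then show ?case using A Cons.IH by simp
  qed (simp add: comb_def)
  have S_meas: "s \<in> borel_measurable M" if "s \<in> S" for s
    using that comb_meas by (auto simp: S_def)
  have S_add: "(\<lambda>x. s x + t x) \<in> S" if "s \<in> S" "t \<in> S" for s t
  proof -
    obtain l where l: "s = comb l" "l \<in> lists (UNIV \<times> \<A>)"
      using \<open>s \<in> S\<close> unfolding S_def by (rule imageE)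
    obtain l' where l': "t = comb l'" "l' \<in> lists (UNIV \<times> \<A>)"
      using \<open>t \<in> S\<close> unfolding S_def by (rule imageE)
    have "(\<lambda>x. s x + t x) = comb (l @ l')"
      by (simp add: l(1) l'(1) comb_def fun_eq_iff)
    then show ?thesis using l(2) l'(2) by (auto simp: S_def)
  qed
  have S_scale: "(\<lambda>x. of_rat r * s x) \<in> S" if "s \<in> S" for s r
  proof -
    obtain l where l: "s = comb l" "l \<in> lists (UNIV \<times> \<A>)"
      using \<open>s \<in> S\<close> unfolding S_def by (rule imageE)
    have "(\<lambda>x. of_rat r * s x) = comb (map (\<lambda>(q, A). (r * q, A)) l)"
      by (simp add: l(1) comb_def fun_eq_iff sum_list_const_mult[symmetric] o_def case_prod_beta of_rat_mult mult.assoc)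
    moreover have "map (\<lambda>(q, A). (r * q, A)) l \<in> lists (UNIV \<times> \<A>)"
      using l(2) by (auto simp: in_lists_conv_set)
    ultimately show ?thesis by (auto simp: S_def)
  qed
  \<comment> \<open>P singles out the functions that S approximates. It holds for indicator
    functions and survives sums, scalar multiples and pointwise limits, so induction over
    nonnegative measurable functions and the decomposition into positive and negative parts reach
    every measurable function.\<close>
  define P where "P f \<longleftrightarrow> f \<in> borel_measurable M \<and>
    (\<forall>K\<in>fmeasurable M. \<forall>e>0. \<exists>s\<in>S. loc_dist M K s f < ennreal e)" for f
  have P_lim: "P u" if U: "\<And>i. P (U i)" and u: "u \<in> borel_measurable M"
    and lim: "\<And>x. x \<in> space M \<Longrightarrow> (\<lambda>i::nat. U i x) \<longlonglongrightarrow> u x" for U u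
    unfolding P_def
  proof (intro conjI ballI allI impI u)
    fix K and e :: real assume K: "K \<in> fmeasurable M" and e: "e > 0"
    have "(\<lambda>i. loc_dist M K u (U i)) \<longlonglongrightarrow> 0"
      using U u K lim by (intro loc_dist_tendsto_0) (auto simp: P_def)
    then have "\<forall>\<^sub>F i in sequentially. loc_dist M K u (U i) < ennreal (e / 2)"
      by (rule order_tendstoD) (use e in simp)
    then obtain i where i: "loc_dist M K u (U i) < ennreal (e / 2)"
      by (auto simp: eventually_sequentially)
    obtain s where s: "s \<in> S" "loc_dist M K s (U i) < ennreal (e / 2)"
      using U[of i] K e unfolding P_def by (meson half_gt_zero)
    have "loc_dist M K s u \<le> loc_dist M K s (U i) + loc_dist M K (U i) u"
      using s(1) S_meas U u K by (intro loc_dist_triangle) (auto simp: P_def)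
    also have "\<dots> < ennreal (e / 2) + ennreal (e / 2)"
      using s i by (intro add_strict_mono) (auto simp: loc_dist_commute)
    also have "\<dots> = ennreal e"
      using e by (simp flip: ennreal_plus)
    finally show "\<exists>s\<in>S. loc_dist M K s u < ennreal e" using s(1) by blast
  qed
  have P_add: "P (\<lambda>x. f x + g x)" if f: "P f" and g: "P g" for f g
    unfolding P_def
  proof (intro conjI ballI allI impI)
    show "(\<lambda>x. f x + g x) \<in> borel_measurable M" using f g by (auto simp: P_def)
    fix K and e :: real assume K: "K \<in> fmeasurable M" and e: "e > 0"
    obtain s t where st: "s \<in> S" "loc_dist M K s f < ennreal (e / 2)" "t \<in> S" "loc_dist M K t g < ennreal (e / 2)"
      using f g K e unfolding P_def by (meson half_gt_zero)
    have "loc_dist M K (\<lambda>x. s x + t x) (\<lambda>x. f x + g x) \<le> loc_dist M K s f + loc_dist M K t g"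
      using st S_meas f g K by (intro loc_dist_add_le) (auto simp: P_def)
    also have "\<dots> < ennreal (e / 2) + ennreal (e / 2)"
      using st by (intro add_strict_mono)
    also have "\<dots> = ennreal e"
      using e by (simp flip: ennreal_plus)
    finally show "\<exists>s\<in>S. loc_dist M K s (\<lambda>x. f x + g x) < ennreal e"
      using S_add st by blast
  qed
  have P_rat: "P (\<lambda>x. of_rat r * f x)" if f: "P f" for f r
    unfolding P_def
  proof (intro conjI ballI allI impI)
    show "(\<lambda>x. of_rat r * f x) \<in> borel_measurable M" using f by (auto simp: P_def)
    fix K and e :: real assume K: "K \<in> fmeasurable M" and e: "e > 0"
    define C where "C = max 1 \<bar>of_rat r :: real\<bar>"
    have C: "C \<ge> 1" "\<bar>of_rat r\<bar> \<le> C" by (simp_all add: C_def)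
    have "e / C > 0" using e C(1) by simp
    then obtain s where s: "s \<in> S" "loc_dist M K s f < ennreal (e / C)"
      using f K \<open>e / C > 0\<close> unfolding P_def by blast
    have "loc_dist M K (\<lambda>x. of_rat r * s x) (\<lambda>x. of_rat r * f x) \<le> ennreal C * loc_dist M K s f"
      using s S_meas f K C by (intro loc_dist_mult_le) (auto simp: P_def)
    also have "\<dots> < ennreal C * ennreal (e / C)"
      using C s(2) by (intro ennreal_mult_strict_left_mono) auto
    also have "\<dots> = ennreal e"
      using C e by (simp flip: ennreal_mult)
    finally show "\<exists>s\<in>S. loc_dist M K s (\<lambda>x. of_rat r * f x) < ennreal e"
      using S_scale[OF s(1)] by blast
  qed
  have P_mult: "P (\<lambda>x. c * f x)" if f: "P f" for f and c :: real
  proof -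
    \<comment> \<open>S is closed under rational scalars only; a real multiple is the pointwise
      limit of rational ones.\<close>
    have "\<exists>r. c < of_rat r \<and> of_rat r < c + 1 / real (Suc n)" for n
      by (rule of_rat_dense) simp
    then obtain r where r: "\<And>n. c < of_rat (r n)" "\<And>n. of_rat (r n) < c + 1 / real (Suc n)"
      by metis
    have "(\<lambda>n. c + 1 / real (Suc n)) \<longlonglongrightarrow> c + 0"
      by (intro tendsto_intros LIMSEQ_Suc[OF lim_1_over_n])
    then have lim: "(\<lambda>n. c + 1 / real (Suc n)) \<longlonglongrightarrow> c"
      by simp
    have "(\<lambda>n. of_rat (r n)) \<longlonglongrightarrow> c"
      by (rule tendsto_sandwich[OF _ _ tendsto_const lim])
        (auto intro!: always_eventually less_imp_le r simp del: of_nat_Suc)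
    then have lim': "(\<lambda>n. of_rat (r n) * f x) \<longlonglongrightarrow> c * f x" for x
      by (rule tendsto_mult_right)
    show ?thesis
    proof (rule P_lim)
      show "P (\<lambda>x. of_rat (r n) * f x)" for n
        using f by (rule P_rat)
      show "(\<lambda>x. c * f x) \<in> borel_measurable M"
        using f unfolding P_def by auto
    qed (rule lim')
  qed
  have P_indicator: "P (indicator A)" if A: "A \<in> sets M" for A
    unfolding P_def
  proof (intro conjI ballI allI impI)
    show "indicator A \<in> borel_measurable M" using A by simp
    fix K and e :: real assume K: "K \<in> fmeasurable M" and e: "e > 0"
    \<comment> \<open>A may have infinite measure, so the approximation is applied to its part in K.
      On K, the indicator functions of A0 and A differ only within the symmetric difference of A0
      and K \<inter> A.\<close>
    have "K \<inter> A \<in> fmeasurable M" using K A by (rule fmeasurable_Int_fmeasurable)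
    from approx[OF this e] obtain A0 where A0: "A0 \<in> \<A>"
        "emeasure M ((K \<inter> A - A0) \<union> (A0 - K \<inter> A)) < ennreal e"
      by blast
    have sets: "A0 \<in> sets M" "K \<in> sets M" using A0 sub K by auto
    have "comb [(1, A0)] = indicator A0"
      by (simp add: comb_def fun_eq_iff)
    then have "indicator A0 \<in> S"
      using A0(1) unfolding S_def by (intro image_eqI[of _ _ "[(1, A0)]"]) auto
    moreover have "loc_dist M K (indicator A0) (indicator A) \<le> (\<integral>\<^sup>+x. indicator ((K \<inter> A - A0) \<union> (A0 - K \<inter> A)) x \<partial>M)"
      unfolding loc_dist_def by (intro nn_integral_mono) (auto simp: indicator_def)
    then have "loc_dist M K (indicator A0) (indicator A) < ennreal e"
      using A0(2) A sets by (subst (asm) nn_integral_indicator) auto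
    ultimately show "\<exists>s\<in>S. loc_dist M K s (indicator A) < ennreal e" by blast
  qed
  have P_nonneg: "P f" if "f \<in> borel_measurable M" "\<And>x. 0 \<le> f x" for f
    using that
  proof (induction rule: borel_measurable_induct_real)
    case (seq U)
    show ?case by (rule P_lim[of U]) (use seq that in blast)+
  qed (auto intro: P_indicator P_mult P_add)
  have "P f" if f: "f \<in> borel_measurable M" for f
  proof -
    have "P (\<lambda>x. max 0 (f x) + (- 1) * max 0 (- f x))"
      using f by (intro P_add P_mult P_nonneg) auto
    also have "(\<lambda>x. max 0 (f x) + (- 1) * max 0 (- f x)) = f"
      by (auto simp: fun_eq_iff)
    finally show ?thesis .
  qed
  moreover have "countable S"
    unfolding S_def using cnt by (intro countable_image countable_lists countable_SIGMA) auto
  ultimately show ?thesis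
    using S_meas unfolding P_def by (intro that[of S]) auto
qed

text \<open>Finite lists over the countable set S, continued by zeros, form a countable family. It
  is dense because only the first N entries have to be approximated.\<close>

lemma separable_sequences:
  assumes S: "countable S" "S \<subseteq> borel_measurable M"
    and dense: "\<And>f K e. \<lbrakk>f \<in> borel_measurable M; K \<in> fmeasurable M; e > (0::real)\<rbrakk> \<Longrightarrow>
      \<exists>s\<in>S. loc_dist M K s f < ennreal e"
  obtains D :: "nat \<Rightarrow> nat \<Rightarrow> 'a \<Rightarrow> real" where "\<And>j n. D j n \<in> borel_measurable M"
    "\<And>j. \<exists>N. \<forall>n\<ge>N. \<forall>x. D j n x = 0"
    "\<And>f K e N. \<lbrakk>\<And>n. f n \<in> borel_measurable M; K \<in> fmeasurable M; e > (0::real)\<rbrakk> \<Longrightarrow>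
      \<exists>j. \<forall>n<N. loc_dist M K (D j n) (f n) < ennreal e"
proof -
  define pad :: "('a \<Rightarrow> real) list \<Rightarrow> nat \<Rightarrow> 'a \<Rightarrow> real"
    where "pad l n = (if n < length l then l ! n else (\<lambda>x. 0))" for l n
  define D where "D = (\<lambda>j. pad (from_nat_into (lists S) j))"
  have lists: "from_nat_into (lists S) j \<in> lists S" for j
    by (rule from_nat_into) (auto simp: lists_empty)
  have cnt: "countable (lists S)" using S(1) by (rule countable_lists)
  show ?thesis
  proof (rule that)
    show "D j n \<in> borel_measurable M" for j n
      using lists[of j] S(2) by (auto simp: D_def pad_def in_lists_conv_set)
    show "\<exists>N. \<forall>n\<ge>N. \<forall>x. D j n x = 0" for j
      by (intro exI[of _ "length (from_nat_into (lists S) j)"]) (auto simp: D_def pad_def)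
    fix f :: "nat \<Rightarrow> 'a \<Rightarrow> real" and K e N
    assume f: "\<And>n. f n \<in> borel_measurable M" and K: "K \<in> fmeasurable M" and e: "e > (0::real)"
    obtain s where s: "\<And>n::nat. s n \<in> S" "\<And>n. loc_dist M K (s n) (f n) < ennreal e"
      using dense[OF f K e] by metis
    have "map s [0..<N] \<in> lists S" using s(1) by auto
    then obtain j where j: "from_nat_into (lists S) j = map s [0..<N]"
      using from_nat_into_surj[OF cnt] by blast
    show "\<exists>j. \<forall>n<N. loc_dist M K (D j n) (f n) < ennreal e"
      using s(2) by (intro exI[of _ j]) (simp add: D_def j pad_def)
  qed
qed

lemma open_unit_interval_eqpoll_reals: "{0<..<1::real} \<approx> (UNIV :: real set)"
proof (rule lepoll_antisym)
  show "{0<..<1::real} \<lesssim> (UNIV :: real set)" by (simp add: subset_imp_lepoll)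
  have "inj (\<lambda>x::real. 1 / (1 + exp x))"
    by (rule injI) (simp add: field_simps)
  moreover have "(\<lambda>x::real. 1 / (1 + exp x)) ` UNIV \<subseteq> {0<..<1}"
    by (auto simp: add_pos_pos)
  ultimately show "(UNIV :: real set) \<lesssim> {0<..<1::real}"
    unfolding lepoll_def by blast
qed

section \<open>Spaceability and dense lineability for a given indexed typewriter\<close>

context indexed_typewriter
begin

lemma spaceable:
  assumes M: "semifinite M"
  shows "spaceable (L0_seq M) (L0_seq_topology M) (S_m M - (S_p M \<union> (\<Union>q\<in>{0<..}. S_L M q)))"
  unfolding spaceable_def
proof (intro exI[of _ multiples] conjI)
  interpret vectorspace class_ring "L0_seq M" by (rule vectorspace_L0_seq)
  show sub: "VectorSpace.subspace class_ring multiples (L0_seq M)"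
    by (intro VectorSpace.subspace.intro vectorspace_L0_seq submodule_multiples)
  show "closedin (L0_seq_topology M) multiples"
    using M by (rule closedin_multiples)
  show "multiples - {\<zero>\<^bsub>L0_seq M\<^esub>} \<subseteq> S_m M - (S_p M \<union> (\<Union>q\<in>{0<..}. S_L M q))"
    using multiples_mem by blast
  interpret V: vectorspace class_ring "L0_seq M\<lparr>carrier := multiples\<rparr>"
    using sub by (rule subspace_is_vs)
  \<comment> \<open>With zero perturbations the vectors are exact multiples of h, which gives an
    infinite linearly independent subset of \<open>multiples\<close>.\<close>
  let ?b = "\<lambda>y. seq_class M (pvec (\<lambda>y n x. 0) y)"
  have li: "\<not> lin_dep (?b ` {0<..<1})" and inj: "inj_on ?b {0<..<1}"
    by (rule pvec_span; simp)+
  have b: "?b ` {0<..<1} \<subseteq> multiples"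
    unfolding multiples_def
  proof (intro image_subsetI)
    fix y :: real
    have "(\<lambda>x. y ^ Suc (\<kappa> x)) \<in> borel_measurable M"
      by (rule measurable_compose[OF measurable_\<kappa>, where g = "\<lambda>k. y ^ Suc k"]) simp
    then show "?b y \<in> (\<lambda>\<phi>. seq_class M (\<lambda>n x. \<phi> x * h n x)) ` borel_measurable M"
      by (rule rev_image_eqI) (simp add: pvec_def[abs_def])
  qed
  show "\<not> V.fin_dim"
  proof
    assume "V.fin_dim"
    then have "finite (?b ` {0<..<1})"
      using li b span_li_not_depend(2)[OF b submodule_multiples] by (intro V.fin_dim_li_fin) auto
    then have "finite {0<..<1::real}"
      using inj by (rule finite_imageD)
    then show False by (simp add: infinite_Ioo)
  qed
qed

lemma c_dense_lineable:
  fixes D :: "nat \<Rightarrow> nat \<Rightarrow> 'a \<Rightarrow> real"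
  assumes D [measurable]: "\<And>j n. D j n \<in> borel_measurable M"
    and D_tail: "\<And>j. \<exists>N. \<forall>n\<ge>N. \<forall>x. D j n x = 0"
    and D_dense: "\<And>f K e N. \<lbrakk>\<And>n. f n \<in> borel_measurable M; K \<in> fmeasurable M; e > (0::real)\<rbrakk> \<Longrightarrow>
      \<exists>j::nat. \<forall>n<N. loc_dist M K (D j n) (f n) < ennreal e"
  shows "c_dense_lineable (L0_seq M) (L0_seq_topology M) (S_m M - (S_p M \<union> (\<Union>q\<in>{0<..}. S_L M q)))"
proof -
  interpret vectorspace class_ring "L0_seq M" by (rule vectorspace_L0_seq)
  txt \<open>For every \<open>j\<close>, the numbers \<open>y = 1 / prod_encode (j, m)\<close> are arbitrarily small and satisfy
    \<open>d y = D j\<close>, so that the basis contains arbitrarily small perturbations of \<open>D j\<close>.\<close>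
  define d where "d y = D (fst (prod_decode (nat \<lfloor>1 / y\<rfloor>)))" for y :: real
  have d [measurable]: "d y n \<in> borel_measurable M" for y n
    by (simp add: d_def)
  have d_tail: "\<exists>N. \<forall>n\<ge>N. \<forall>x. d y n x = 0" for y
    using D_tail by (simp add: d_def)
  define b where "b y = seq_class M (pvec d y)" for y
  define B where "B = b ` {0<..<1}"
  note span_facts = pvec_span[of d, OF d d_tail, folded b_def, folded B_def]
  have B: "B \<subseteq> carrier (L0_seq M)" and inj: "inj_on b {0<..<1}" and li: "\<not> lin_dep B"
    using span_facts by auto
  have sub: "VectorSpace.subspace class_ring (span B) (L0_seq M)"
    using B by (rule span_is_subspace)
  have span_car: "span B \<subseteq> carrier (L0_seq M)"
    using B by (rule span_is_subset2)
  have B_span: "B \<subseteq> span B"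
    using B by (rule in_own_span)
  show ?thesis
    unfolding c_dense_lineable_def
  proof (rule exI[of _ "span B"], intro conjI)
    show "VectorSpace.subspace class_ring (span B) (L0_seq M)" by fact
    show "span B - {\<zero>\<^bsub>L0_seq M\<^esub>} \<subseteq> S_m M - (S_p M \<union> (\<Union>q\<in>{0<..}. S_L M q))"
      using span_facts by blast
    interpret V: vectorspace class_ring "L0_seq M\<lparr>carrier := span B\<rparr>"
      using sub by (rule subspace_is_vs)
    \<comment> \<open>Span and linear independence are the same relative to the subspace as in the
      whole space.\<close>
    have "V.basis B"
      using span_li_not_depend[OF B_span span_is_submodule[OF B]] li B_span
      by (simp add: V.basis_def)
    moreover have "B \<approx> {0<..<1::real}"
      unfolding B_def using inj by (rule inj_on_image_eqpoll_self)
    then have "B \<approx> (UNIV :: real set)"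
      using open_unit_interval_eqpoll_reals by (rule eqpoll_trans)
    ultimately show "\<exists>B. V.basis B \<and> B \<approx> (UNIV :: real set)"
      by blast
    have "F \<in> L0_seq_topology M closure_of span B" if F: "F \<in> carrier (L0_seq M)" for F
    proof -
      obtain f where f [measurable]: "\<And>n. f n \<in> borel_measurable M" and F: "F = seq_class M f"
        using F by (auto simp: carrier_L0_seq)
      show ?thesis
        unfolding F seq_class_in_closure_iff[OF f span_car]
      proof (intro ballI allI impI)
        fix K and e :: real and N :: nat
        assume K: "K \<in> fmeasurable M" and e: "e > 0"
        have [measurable]: "K \<in> sets M" using K by auto
        have "\<exists>j. \<forall>n<N. loc_dist M K (D j n) (f n) < ennreal (e / 2)"
          by (rule D_dense) (use K e in auto)
        then obtain j where j: "\<And>n. n < N \<Longrightarrow> loc_dist M K (D j n) (f n) < ennreal (e / 2)"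
          by blast
        obtain C where C: "\<And>n x. \<bar>h n x\<bar> \<le> C n"
          using h_bounded by metis
        \<comment> \<open>The sum of the nonnegative bounds dominates each of them and so bounds all
          of the finitely many h n with n < N.\<close>
        define C' where "C' = (\<Sum>n<N. C n)"
        have C_nonneg: "C n \<ge> 0" for n
          using C[of n undefined] by linarith
        have C'_nonneg: "C' \<ge> 0"
          unfolding C'_def by (intro sum_nonneg C_nonneg)
        have C': "\<bar>h n x\<bar> \<le> C'" if "n < N" for n x
          using C[of n x] member_le_sum[of n "{..<N}" C] that C_nonneg by (force simp: C'_def)
        \<comment> \<open>As i \<ge> m, the bound 2 gives y < 1. The other bound makes C' y times
          the measure of K, which controls the perturbation on K, less than e / 2.\<close>
        obtain m where m: "real m > 2 * C' * measure M K / e" "m \<ge> 2"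
          using reals_Archimedean2[of "max 2 (2 * C' * measure M K / e)"] by auto
        define i where "i = prod_encode (j, m)"
        define y where "y = 1 / real i"
        have i: "i \<ge> m" unfolding i_def by (rule le_prod_encode_2)
        have y: "y \<in> {0<..<1}" using i m(2) by (auto simp: y_def)
        have "d y = D j"
          using i m(2) by (simp add: d_def y_def i_def)
        have small: "C' * y * measure M K < e / 2"
        proof -
          have "2 * C' * measure M K < e * real i"
            using m(1) i e by (smt (verit) divide_less_eq mult.commute mult_left_mono of_nat_le_iff)
          then show ?thesis using y by (simp add: y_def field_simps)
        qed
        have "loc_dist M K (pvec d y n) (f n) < ennreal e" if n: "n < N" for n
        proof -
          have "loc_dist M K (pvec d y n) (f n) \<le> loc_dist M K (pvec d y n) (D j n) + loc_dist M K (D j n) (f n)"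
            by (rule loc_dist_triangle) measurable
          also have "loc_dist M K (pvec d y n) (D j n) \<le> ennreal (C' * y) * emeasure M K"
          proof (rule loc_dist_bound)
            fix x
            have "y ^ Suc (\<kappa> x) \<le> y"
              using y power_le_one[of y "\<kappa> x"] mult_left_le[of "y ^ \<kappa> x" y] by simp
            then have "y ^ Suc (\<kappa> x) * \<bar>h n x\<bar> \<le> y * C'"
              using C'[OF n, of x] y by (intro mult_mono) auto
            then show "\<bar>pvec d y n x - D j n x\<bar> \<le> C' * y"
              using y by (simp add: pvec_def \<open>d y = D j\<close> abs_mult mult.commute)
          qed (use y C'_nonneg in auto)
          also have "\<dots> = ennreal (C' * y * measure M K)"
            using K y C'_nonneg by (simp add: emeasure_eq_measure2 ennreal_mult)
          also have "\<dots> \<le> ennreal (e / 2)"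
            using small by (intro ennreal_leI) simp
          finally have "loc_dist M K (pvec d y n) (f n) \<le> ennreal (e / 2) + loc_dist M K (D j n) (f n)"
            by (simp add: add_right_mono)
          also have "\<dots> < ennreal (e / 2) + ennreal (e / 2)"
            using j[OF n] by (simp add: ennreal_add_left_cancel_less)
          also have "\<dots> = ennreal e"
            using e by (simp flip: ennreal_plus)
          finally show ?thesis .
        qed
        moreover have "seq_class M (pvec d y) \<in> span B"
          using B_span y by (auto simp: B_def b_def)
        ultimately show "\<exists>g. (\<forall>n. g n \<in> borel_measurable M) \<and> seq_class M g \<in> span B \<and>
            (\<forall>n<N. loc_dist M K (g n) (f n) < ennreal e)"
          by (intro exI[of _ "pvec d y"]) auto
      qed
    qed
    then show "L0_seq_topology M closure_of span B = topspace (L0_seq_topology M)"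
      unfolding topspace_L0_seq_topology[symmetric]
      using closure_of_subset_topspace[of "L0_seq_topology M" "span B"] by blast
  qed
qed

end

lemma indexed_typewriter_exists:
  assumes M: "nonatomic M" and W: "W \<in> fmeasurable M" "emeasure M W > 0"
  obtains h \<kappa> where "indexed_typewriter M W h \<kappa>"
proof -
  have "measure M W > 0"
    using W by (simp add: emeasure_eq_measure2)
  then obtain h where h: "typewriter M W h"
    using typewriter_exists[OF M W(1)] by blast
  obtain \<kappa> :: "'a \<Rightarrow> nat" where "\<kappa> \<in> measurable M (count_space UNIV)"
      "\<And>k. emeasure M {x \<in> space M. x \<in> W \<and> \<kappa> x = k} > 0"
    using nonatomic_partition_index[OF M fmeasurableD[OF W(1)] W(2)] by blast
  then show ?thesis
    using h by (intro that[of h \<kappa>] indexed_typewriter.intro indexed_typewriter_axioms.intro)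
qed

theorem theorem3p6:
  fixes M :: "'a measure"
  assumes "emeasure M (space M) > 0"
    and "nonatomic M"
  shows "(sigma_finite_measure M \<and>
      (\<exists>\<A>\<subseteq>sets M. countable \<A> \<and>
        (\<forall>A\<in>sets M. emeasure M A < \<infinity> \<longrightarrow>
          (\<forall>e>0::real. \<exists>A0\<in>\<A>. emeasure M ((A - A0) \<union> (A0 - A)) < ennreal e)))
      \<longrightarrow> c_dense_lineable (L0_seq M) (L0_seq_topology M)
            (S_m M - (S_p M \<union> (\<Union>q\<in>{0<..}. S_L M q))))
    \<and> (semifinite M
      \<longrightarrow> spaceable (L0_seq M) (L0_seq_topology M)
            (S_m M - (S_p M \<union> (\<Union>q\<in>{0<..}. S_L M q))))"
proof (intro conjI impI)
  assume "sigma_finite_measure M \<and>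
      (\<exists>\<A>\<subseteq>sets M. countable \<A> \<and>
        (\<forall>A\<in>sets M. emeasure M A < \<infinity> \<longrightarrow>
          (\<forall>e>0::real. \<exists>A0\<in>\<A>. emeasure M ((A - A0) \<union> (A0 - A)) < ennreal e)))"
  then obtain \<A> where "sigma_finite_measure M" and \<A>: "\<A> \<subseteq> sets M" "countable \<A>"
    and approx: "\<forall>A\<in>sets M. emeasure M A < \<infinity> \<longrightarrow>
          (\<forall>e>0::real. \<exists>A0\<in>\<A>. emeasure M ((A - A0) \<union> (A0 - A)) < ennreal e)"
    by blast
  interpret sigma_finite_measure M by fact
  obtain A :: "nat \<Rightarrow> 'a set" where A: "range A \<subseteq> sets M" "(\<Union>i. A i) = space M" "\<And>i. emeasure M (A i) \<noteq> \<infinity>"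
    using sigma_finite by metis
  \<comment> \<open>A countable union of null sets cannot be the whole space, which has positive
    measure; this supplies W.\<close>
  have "\<exists>i. emeasure M (A i) \<noteq> 0"
  proof (rule ccontr)
    assume "\<nexists>i. emeasure M (A i) \<noteq> 0"
    then have "emeasure M (\<Union>i. A i) = 0"
      using A(1) by (intro emeasure_UN_eq_0) auto
    then show False using A(2) assms(1) by simp
  qed
  then obtain i where i: "emeasure M (A i) > 0"
    by (auto simp: zero_less_iff_neq_zero)
  have "A i \<in> fmeasurable M"
    using A by (intro fmeasurableI) (auto simp: less_top)
  then obtain h \<kappa> where "indexed_typewriter M (A i) h \<kappa>"
    using indexed_typewriter_exists[OF assms(2) _ i] by blast
  then interpret indexed_typewriter M "A i" h \<kappa> .
  obtain S where S: "countable S" "S \<subseteq> borel_measurable M"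
    "\<And>f K e. \<lbrakk>f \<in> borel_measurable M; K \<in> fmeasurable M; e > (0::real)\<rbrakk> \<Longrightarrow> \<exists>s\<in>S. loc_dist M K s f < ennreal e"
    by (rule separable_loc_dist[OF \<A>]) (use approx in \<open>auto simp: fmeasurable_def\<close>)
  show "c_dense_lineable (L0_seq M) (L0_seq_topology M) (S_m M - (S_p M \<union> (\<Union>q\<in>{0<..}. S_L M q)))"
    (is ?thesis)
  proof (rule separable_sequences[OF S])
    fix D :: "nat \<Rightarrow> nat \<Rightarrow> 'a \<Rightarrow> real"
    assume "\<And>j n. D j n \<in> borel_measurable M" "\<And>j. \<exists>N. \<forall>n\<ge>N. \<forall>x. D j n x = 0"
      "\<And>f K e N. \<lbrakk>\<And>n. f n \<in> borel_measurable M; K \<in> fmeasurable M; e > (0::real)\<rbrakk> \<Longrightarrow>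
        \<exists>j. \<forall>n<N. loc_dist M K (D j n) (f n) < ennreal e"
    then show ?thesis by (rule c_dense_lineable)
  qed
next
  assume M: "semifinite M"
  \<comment> \<open>If all sets of finite measure were null, semifiniteness would make the whole
    space null.\<close>
  have "\<exists>K\<in>fmeasurable M. emeasure M K > 0"
    using semifinite_null_setI[OF M sets.top] assms(1) by (force simp: zero_less_iff_neq_zero)
  then obtain K where "K \<in> fmeasurable M" "emeasure M K > 0" by blast
  then obtain h \<kappa> where "indexed_typewriter M K h \<kappa>"
    using indexed_typewriter_exists[OF assms(2)] by blast
  then interpret indexed_typewriter M K h \<kappa> .
  show "spaceable (L0_seq M) (L0_seq_topology M) (S_m M - (S_p M \<union> (\<Union>q\<in>{0<..}. S_L M q)))"
    using M by (rule spaceable)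
qed

end
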